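(* Let $(B_t; t\ge 0)$ be standard one-dimensional Brownian motion and for $t\ge 0$ let $\alpha_t:=\sup\{s\in[0,1]: B_{t+s}=\inf_{u\in[0,1]}B_{t+u}\}$. Then the process $(\alpha_t; t\ge 0)$ is stationary, and its invariant measure (the law of $\alpha_t$ for every $t\geq 0$) is the arcsine distribution with density $$f(x)=\frac{1}{\pi\sqrt{x(1-x)}}\quad\text{for } 0<x<1.$$
   Context: The process $(\alpha_t;t\ge0)$ is called the argmin process of Brownian motion. *)

theory Defs
  imports "HOL-Probability.Probability"
begin

text \<open>
  Processes are indexed by real numbers, but only the times \<open>t \<ge> 0\<close> matter. Paths are
  continuous for every \<open>\<omega>\<close>, rather than almost every one, because the underlying space is
  not assumed to be complete: pathwise functionals such as the argmin below could otherwise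
  fail to be measurable.
\<close>

locale standard_brownian_motion = prob_space M
  for M :: "'a measure" and B :: "real \<Rightarrow> 'a \<Rightarrow> real" +
  assumes measurable_B: "\<And>t. 0 \<le> t \<Longrightarrow> random_variable borel (B t)"
    and starts_at_0: "AE \<omega> in M. B 0 \<omega> = 0"
    and continuous_paths: "\<And>\<omega>. \<omega> \<in> space M \<Longrightarrow> continuous_on {0..} (\<lambda>t. B t \<omega>)"
    and indep_increments:
      "\<And>(t :: nat \<Rightarrow> real) n. 0 \<le> t 0 \<Longrightarrow> mono_on {..n} t \<Longrightarrow>
        indep_vars (\<lambda>_. borel) (\<lambda>i \<omega>. B (t (Suc i)) \<omega> - B (t i) \<omega>) {..<n}"
    and normal_increments:
      "\<And>s t. 0 \<le> s \<Longrightarrow> s < t \<Longrightarrow>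
        distributed M lborel (\<lambda>\<omega>. B t \<omega> - B s \<omega>) (normal_density 0 (sqrt (t - s)))"

definition argmin_process :: "(real \<Rightarrow> 'a \<Rightarrow> real) \<Rightarrow> real \<Rightarrow> 'a \<Rightarrow> real" where
  "argmin_process B t \<omega> =
    Sup {s \<in> {0..1}. B (t + s) \<omega> = (INF u\<in>{0..1}. B (t + u) \<omega>)}"

text \<open>
  Stationarity: all finite-dimensional distributions are invariant under time shifts.
  Measurability is part of the definition since \<^const>\<open>distr\<close> is only meaningful for
  measurable maps.
\<close>

definition stationary_process :: "'a measure \<Rightarrow> (real \<Rightarrow> 'a \<Rightarrow> real) \<Rightarrow> bool" where
  "stationary_process M X \<longleftrightarrow>
    (\<forall>t\<ge>0. X t \<in> borel_measurable M) \<and>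
    (\<forall>h\<ge>0. \<forall>J. finite J \<and> J \<subseteq> {0..} \<longrightarrow>
      distr M (\<Pi>\<^sub>M j\<in>J. borel) (\<lambda>\<omega>. \<lambda>j\<in>J. X (j + h) \<omega>) =
      distr M (\<Pi>\<^sub>M j\<in>J. borel) (\<lambda>\<omega>. \<lambda>j\<in>J. X j \<omega>))"

definition arcsine_density :: "real \<Rightarrow> real" where
  "arcsine_density x = (if 0 < x \<and> x < 1 then 1 / (pi * sqrt (x * (1 - x))) else 0)"

end

theory Submission
  imports Defs
begin

text \<open>
  The last argmin over \<open>[t, t + 1]\<close> is a measurable functional of countably many increments
  \<open>B (t + q) - B 0\<close>. Since \<open>B (h + _) - B h\<close> is again a standard Brownian motion, and the law
  of a Brownian path on a countable time set is determined by the axioms, the process is stationary.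

  For the one-dimensional law, restrict \<open>B\<close> to the grid \<open>{0, 1/n, ..., 1}\<close>. The grid walk splits at
  its last minimum into two independent pieces, so the minimum is at \<open>k\<close> with probability
  \<open>p k * p (n - k)\<close>, where by symmetry of the steps the same \<open>p m\<close> (the probability that \<open>m\<close> steps
  stay positive) serves both sides. As these probabilities sum to 1 for every \<open>n\<close>, the generating
  function of \<open>p\<close> is \<open>(1 - x) powr (-1/2)\<close>, whence \<open>p n\<close> is asymptotically \<open>1 / sqrt (pi * n)\<close>.
  The minimum of \<open>B\<close> is almost surely unique, so the grid argmins converge to the argmin, and Fatou's
  lemma bounds its law from below by the arcsine law. Both have mass 1, so they coincide.
\<close>

section \<open>The law of a Brownian path\<close>

text \<open>Independence turns the joint law into the product of the marginals, so it suffices to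
  compare the marginals.\<close>

lemma (in prob_space) distr_indep_vars_cong:
  assumes X: "indep_vars N X I" and Y: "indep_vars N Y I" and "finite I"
    and eq: "\<And>i. i \<in> I \<Longrightarrow> distr M (N i) (X i) = distr M (N i) (Y i)"
  shows "distr M (PiM I N) (\<lambda>\<omega>. \<lambda>i\<in>I. X i \<omega>) = distr M (PiM I N) (\<lambda>\<omega>. \<lambda>i\<in>I. Y i \<omega>)"
proof (cases "I = {}")
  case True
  then show ?thesis by (simp add: restrict_def)
next
  case False
  have "random_variable (N i) (X i)" "random_variable (N i) (Y i)" if "i \<in> I" for i
    using X Y that by (auto simp: indep_vars_def)
  then show ?thesis
    using X Y False eq by (simp add: indep_vars_iff_distr_eq_PiM' cong: PiM_cong)
qed

text \<open>Increments are only controlled along sorted times, so a finite set of times is embedded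
  in a strictly increasing sequence. Starting it at 0 makes partial sums of increments telescope
  down to \<open>B 0\<close>.\<close>

lemma sorted_enumeration:
  fixes J :: "real set"
  assumes "finite J" "J \<subseteq> {0..}"
  obtains t :: "nat \<Rightarrow> real" and n where "t 0 = 0" "strict_mono_on {..n} t" "J \<subseteq> t ` {..n}"
proof -
  define xs where "xs = sorted_list_of_set (insert 0 J)"
  have set: "set xs = insert 0 J" and sorted: "sorted_wrt (<) xs"
    using assms unfolding xs_def by (auto simp del: sorted_list_of_set_insert_remove)
  then obtain n where n: "length xs = Suc n"
    by (cases xs) auto
  have *: "xs ! i < xs ! j" if "i < j" "j \<le> n" for i j
    using sorted that n by (auto simp: sorted_wrt_iff_nth_less)
  obtain k where k: "k \<le> n" "xs ! k = 0"
    using set n by (metis in_set_conv_nth insertI1 less_Suc_eq_le)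
  have "xs ! 0 \<in> insert 0 J"
    using set n by (metis nth_mem zero_less_Suc)
  then have "0 \<le> xs ! 0"
    using assms by auto
  with k * have "xs ! 0 = 0"
    by (metis gr0I leD)
  moreover have "J \<subseteq> (!) xs ` {..n}"
  proof
    fix x assume "x \<in> J"
    then have "x \<in> set xs" by (simp add: set)
    then show "x \<in> (!) xs ` {..n}"
      unfolding in_set_conv_nth n less_Suc_eq_le by auto
  qed
  ultimately show thesis
    using that[of "(!) xs" n] * by (auto simp: strict_mono_on_def)
qed

text \<open>Increments of the shifted process are increments of \<open>B\<close> at shifted times,
  because \<open>B h\<close> cancels; subtracting \<open>B h\<close> restores the start at
  0.\<close>

lemma standard_brownian_motion_shift:
  assumes "standard_brownian_motion M B" "0 \<le> h"
  shows "standard_brownian_motion M (\<lambda>t \<omega>. B (h + t) \<omega> - B h \<omega>)"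
proof -
  interpret standard_brownian_motion M B by fact
  show ?thesis
  proof
    show "random_variable borel (\<lambda>\<omega>. B (h + t) \<omega> - B h \<omega>)" if "0 \<le> t" for t
      using that assms by (intro borel_measurable_diff measurable_B) auto
    show "continuous_on {0..} (\<lambda>t. B (h + t) \<omega> - B h \<omega>)" if "\<omega> \<in> space M" for \<omega>
      using assms by (intro continuous_intros continuous_on_compose2[OF continuous_paths[OF that]]) auto
    show "indep_vars (\<lambda>_. borel) (\<lambda>i \<omega>. B (h + t (Suc i)) \<omega> - B h \<omega> - (B (h + t i) \<omega> - B h \<omega>)) {..<n}"
      if "0 \<le> t 0" "mono_on {..n} t" for t :: "nat \<Rightarrow> real" and n
      using indep_increments[of "\<lambda>i. h + t i" n] that assms by (simp add: mono_on_def)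
    show "distributed M lborel (\<lambda>\<omega>. B (h + t) \<omega> - B h \<omega> - (B (h + s) \<omega> - B h \<omega>)) (normal_density 0 (sqrt (t - s)))"
      if "0 \<le> s" "s < t" for s t
      using normal_increments[of "h + s" "h + t"] that assms by simp
  qed simp_all
qed

text \<open>For both processes the increments are independent and normal with the same variances.
  Strict monotonicity matches \<open>normal_increments\<close>, which speaks of
  \<open>s < t\<close>.\<close>

lemma distr_brownian_increments:
  fixes t :: "nat \<Rightarrow> real"
  assumes B: "standard_brownian_motion M B" and B': "standard_brownian_motion M B'"
    and t: "0 \<le> t 0" "strict_mono_on {..n} t"
  shows "distr M (PiM {..<n} (\<lambda>_. borel)) (\<lambda>\<omega>. \<lambda>i\<in>{..<n}. B (t (Suc i)) \<omega> - B (t i) \<omega>) =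
    distr M (PiM {..<n} (\<lambda>_. borel)) (\<lambda>\<omega>. \<lambda>i\<in>{..<n}. B' (t (Suc i)) \<omega> - B' (t i) \<omega>)"
proof -
  interpret B: standard_brownian_motion M B by fact
  interpret B': standard_brownian_motion M B' by fact
  have mono: "mono_on {..n} t"
    using t(2) by (rule strict_mono_on_imp_mono_on)
  show ?thesis
  proof (rule B.distr_indep_vars_cong)
    fix i assume i: "i \<in> {..<n}"
    have "t 0 \<le> t i" "t i < t (Suc i)"
      using i t mono by (auto simp: mono_on_def strict_mono_on_def)
    then have "0 \<le> t i" "t i < t (Suc i)"
      using t by auto
    then have "distr M lborel (\<lambda>\<omega>. B (t (Suc i)) \<omega> - B (t i) \<omega>) =
      distr M lborel (\<lambda>\<omega>. B' (t (Suc i)) \<omega> - B' (t i) \<omega>)"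
      using B.normal_increments B'.normal_increments by (simp add: distributed_def)
    then show "distr M borel (\<lambda>\<omega>. B (t (Suc i)) \<omega> - B (t i) \<omega>) =
      distr M borel (\<lambda>\<omega>. B' (t (Suc i)) \<omega> - B' (t i) \<omega>)"
      by (simp cong: distr_cong)
  qed (use B.indep_increments B'.indep_increments t mono in auto)
qed

lemma measurable_brownian_path:
  assumes "standard_brownian_motion M B" "Q \<subseteq> {0..}"
  shows "(\<lambda>\<omega>. \<lambda>r\<in>Q. B r \<omega> - B 0 \<omega>) \<in> M \<rightarrow>\<^sub>M PiM Q (\<lambda>_. borel)"
proof -
  interpret standard_brownian_motion M B by fact
  show ?thesis
    using assms(2) by (intro measurable_restrict borel_measurable_diff measurable_B) auto
qed

text \<open>A finite measure on the product space is determined by finite cylinders, and a cylinder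
  over finitely many times is an event about finitely many increments, whose joint law is already
  fixed.\<close>

lemma distr_brownian_path:
  assumes B: "standard_brownian_motion M B" and B': "standard_brownian_motion M B'"
    and Q: "Q \<subseteq> {0..}"
  shows "distr M (PiM Q (\<lambda>_. borel)) (\<lambda>\<omega>. \<lambda>r\<in>Q. B r \<omega> - B 0 \<omega>) =
    distr M (PiM Q (\<lambda>_. borel)) (\<lambda>\<omega>. \<lambda>r\<in>Q. B' r \<omega> - B' 0 \<omega>)" (is "distr M ?P ?X = distr M ?P ?X'")
proof -
  interpret B: standard_brownian_motion M B by fact
  interpret B': standard_brownian_motion M B' by fact
  note meas = measurable_brownian_path[OF B Q] measurable_brownian_path[OF B' Q]
  show ?thesis
  proof (rule measure_eqI_PiM_infinite)
    fix A :: "real \<Rightarrow> real set" and J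
    assume J: "finite J" "J \<subseteq> Q" and A: "\<And>i. i \<in> J \<Longrightarrow> A i \<in> sets borel"
    obtain t :: "nat \<Rightarrow> real" and n where t: "t 0 = 0" "strict_mono_on {..n} t" "J \<subseteq> t ` {..n}"
      using sorted_enumeration[of J] J Q by (metis subset_trans)
    \<comment> \<open>The cylinder condition in increment coordinates: since \<open>t 0 = 0\<close>,
      the first \<open>k\<close> increments add up to \<open>B (t k) - B 0\<close>. The same set
      serves \<open>B\<close> and \<open>B'\<close>.\<close>
    define S where "S = {x \<in> space (PiM {..<n} (\<lambda>_. borel)). \<forall>k\<in>{..n}. t k \<in> J \<longrightarrow> (\<Sum>i<k. x i) \<in> A (t k)}"
    have S: "S \<in> sets (PiM {..<n} (\<lambda>_. borel :: real measure))"
    proof -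
      have "(\<lambda>x. t k \<in> J \<longrightarrow> (\<Sum>i<k. x i) \<in> A (t k)) \<in> measurable (PiM {..<n} (\<lambda>_. borel :: real measure)) (count_space UNIV)"
        if "k \<in> {..n}" for k
      proof (cases "t k \<in> J")
        case True
        have [measurable]: "A (t k) \<in> sets borel" using A[OF True] .
        have "i \<in> {..<n}" if "i < k" for i using that \<open>k \<in> {..n}\<close> by auto
        then have [measurable]: "(\<lambda>x. \<Sum>i<k. x i) \<in> borel_measurable (PiM {..<n} (\<lambda>_. borel :: real measure))"
          by (intro borel_measurable_sum measurable_component_singleton) auto
        show ?thesis by measurable
      qed simp
      then show ?thesis unfolding S_def by measurable
    qed
    have emb: "emeasure (distr M ?P (\<lambda>\<omega>. \<lambda>r\<in>Q. W r \<omega> - W 0 \<omega>)) (prod_emb Q (\<lambda>_. borel) J (Pi\<^sub>E J A)) =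
      emeasure (distr M (PiM {..<n} (\<lambda>_. borel)) (\<lambda>\<omega>. \<lambda>i\<in>{..<n}. W (t (Suc i)) \<omega> - W (t i) \<omega>)) S"
      if W: "W = B \<or> W = B'" for W
    proof -
      have bm: "standard_brownian_motion M W" using B B' W by auto
      interpret W: standard_brownian_motion M W by fact
      have nn: "0 \<le> t k" if "k \<le> n" for k
        using mono_onD[OF strict_mono_on_imp_mono_on[OF t(2)], of 0 k] that t(1) by simp
      have incr: "(\<lambda>\<omega>. \<lambda>i\<in>{..<n}. W (t (Suc i)) \<omega> - W (t i) \<omega>) \<in> M \<rightarrow>\<^sub>M PiM {..<n} (\<lambda>_. borel)"
        using nn by (intro measurable_restrict borel_measurable_diff W.measurable_B) auto
      have sum: "(\<Sum>i<k. W (t (Suc i)) \<omega> - W (t i) \<omega>) = W (t k) \<omega> - W 0 \<omega>" for k \<omega>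
        using t sum_lessThan_telescope[of "\<lambda>i. W (t i) \<omega>" k] by simp
      have "(\<lambda>\<omega>. \<lambda>r\<in>Q. W r \<omega> - W 0 \<omega>) -` prod_emb Q (\<lambda>_. borel) J (Pi\<^sub>E J A) \<inter> space M =
        {\<omega> \<in> space M. \<forall>r\<in>J. W r \<omega> - W 0 \<omega> \<in> A r}"
        using J by (auto simp: prod_emb_def space_PiM PiE_iff subset_eq)
      also have "\<dots> = {\<omega> \<in> space M. \<forall>k\<in>{..n}. t k \<in> J \<longrightarrow> W (t k) \<omega> - W 0 \<omega> \<in> A (t k)}"
        using t(3) by (fastforce simp: subset_eq image_iff)
      also have "\<dots> = (\<lambda>\<omega>. \<lambda>i\<in>{..<n}. W (t (Suc i)) \<omega> - W (t i) \<omega>) -` S \<inter> space M"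
        using measurable_space[OF incr] by (auto simp: S_def sum)
      finally show ?thesis
        using W S J A meas incr by (subst (1 2) emeasure_distr) auto
    qed
    show "emeasure (distr M ?P ?X) (prod_emb Q (\<lambda>_. borel) J (Pi\<^sub>E J A)) =
      emeasure (distr M ?P ?X') (prod_emb Q (\<lambda>_. borel) J (Pi\<^sub>E J A))"
      using t by (simp add: emb distr_brownian_increments[OF B B'])
  next
    show "finite_measure (distr M ?P ?X)"
      using meas by (intro prob_space.finite_measure B.prob_space_distr) auto
  qed simp_all
qed

section \<open>The last argmin as a functional of the path\<close>

text \<open>By continuity the minimum is attained and the minimisers form a closed bounded set, so
  their supremum is again a minimiser, hence the last one.\<close>

lemma last_argmin:
  fixes w :: "real \<Rightarrow> real"
  assumes w: "continuous_on {0..1} w"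
  defines "\<alpha> \<equiv> Sup {s \<in> {0..1}. w s = (INF u\<in>{0..1}. w u)}"
  shows "\<alpha> \<in> {0..1}" and "u \<in> {0..1} \<Longrightarrow> w \<alpha> \<le> w u"
    and "s \<in> {0..1} \<Longrightarrow> (\<And>u. u \<in> {0..1} \<Longrightarrow> w s \<le> w u) \<Longrightarrow> s \<le> \<alpha>"
proof -
  define S where "S = {s \<in> {0..1}. w s = (INF u\<in>{0..1}. w u)}"
  obtain m where m: "m \<in> {0..1}" "\<And>u. u \<in> {0..1} \<Longrightarrow> w m \<le> w u"
    using continuous_attains_inf[OF compact_Icc _ w] by auto
  have inf: "(INF u\<in>{0..1}. w u) = w s" if "s \<in> {0..1}" "\<And>u. u \<in> {0..1} \<Longrightarrow> w s \<le> w u" for s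
    using that by (intro cInf_eq_minimum) auto
  have S: "S = {s \<in> {0..1}. w s = w m}"
    using inf[OF m] by (simp add: S_def)
  have "closed S"
    unfolding S by (intro continuous_closed_preimage_constant w) simp
  moreover have "bdd_above S" "S \<noteq> {}"
    using m by (auto simp: S)
  ultimately have "\<alpha> \<in> S"
    unfolding \<alpha>_def S_def[symmetric] by (intro closed_contains_Sup)
  then show "\<alpha> \<in> {0..1}" "u \<in> {0..1} \<Longrightarrow> w \<alpha> \<le> w u"
    using m by (auto simp: S)
  show "s \<le> \<alpha>" if "s \<in> {0..1}" "\<And>u. u \<in> {0..1} \<Longrightarrow> w s \<le> w u"
    unfolding \<alpha>_def S_def[symmetric]
    using that \<open>bdd_above S\<close> inf[OF that] by (intro cSup_upper) (auto simp: S_def)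
qed

lemma continuous_on_approx_Rats:
  fixes w :: "real \<Rightarrow> real"
  assumes w: "continuous_on {a..b} w" and "a < b" and s: "s \<in> {a..b}" and "0 < e"
  obtains q where "q \<in> \<rat> \<inter> {a..b}" "\<bar>w q - w s\<bar> < e"
proof -
  obtain d where d: "0 < d" "\<And>u. u \<in> {a..b} \<Longrightarrow> dist u s < d \<Longrightarrow> dist (w u) (w s) < e"
    using w s \<open>0 < e\<close> unfolding continuous_on_iff by blast
  \<comment> \<open>This open interval is nonempty even if \<open>s\<close> is an endpoint, because
    \<open>a < b\<close>.\<close>
  have "max a (s - d) < min b (s + d)"
    using s d \<open>a < b\<close> by auto
  then obtain q where "q \<in> \<rat>" "max a (s - d) < q" "q < min b (s + d)"
    using Rats_dense_in_real by blast
  with d(2)[of q] show thesis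
    by (intro that[of q]) (auto simp: dist_real_def)
qed

text \<open>
  \<open>x\<close> is at most the last argmin iff the infimum over \<open>[x, 1]\<close> does not exceed the one over
  \<open>[0, x]\<close>; the bound \<open>1 / Suc k\<close> expresses this for the values at rational times only.
\<close>

definition argmin_functional :: "real \<Rightarrow> (real \<Rightarrow> real) \<Rightarrow> real" where
  "argmin_functional j w = (SUP x\<in>\<rat> \<inter> {0<..<1}.
    if \<forall>q\<in>\<rat> \<inter> {0..x}. \<forall>k::nat. \<exists>q'\<in>\<rat> \<inter> {x..1}. w (j + q') < w (j + q) + 1 / Suc k then x else 0)"

text \<open>Forwards, rational times in \<open>[x, 1]\<close> near \<alpha> come arbitrarily close
  to the global minimum. Backwards, the minimiser \<open>s\<close> over \<open>[x, 1]\<close> beats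
  all rational times in \<open>[0, x]\<close>, by continuity then all times; so it is a global
  minimiser and lies below the last one.\<close>

lemma le_last_argmin_iff:
  fixes w :: "real \<Rightarrow> real"
  assumes w: "continuous_on {0..1} w" and x: "0 < x" "x < 1"
  defines "\<alpha> \<equiv> Sup {s \<in> {0..1}. w s = (INF u\<in>{0..1}. w u)}"
  shows "x \<le> \<alpha> \<longleftrightarrow> (\<forall>q\<in>\<rat> \<inter> {0..x}. \<forall>k::nat. \<exists>q'\<in>\<rat> \<inter> {x..1}. w q' < w q + 1 / Suc k)"
proof safe
  note \<alpha> = last_argmin[OF w, folded \<alpha>_def]
  have wx: "continuous_on {0..x} w" "continuous_on {x..1} w"
    using x by (auto intro: continuous_on_subset[OF w])
  {
    fix q and k :: nat assume "x \<le> \<alpha>" and q: "q \<in> \<rat>" "q \<in> {0..x}"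
    have "\<alpha> \<in> {x..1}" using \<alpha>(1) \<open>x \<le> \<alpha>\<close> by auto
    then obtain q' where q': "q' \<in> \<rat> \<inter> {x..1}" "\<bar>w q' - w \<alpha>\<bar> < 1 / Suc k"
      using continuous_on_approx_Rats[OF wx(2) x(2)] by (metis of_nat_0_less_iff zero_less_Suc zero_less_divide_1_iff)
    then have "w q' < w q + 1 / Suc k"
      using \<alpha>(2)[of q] q x by (auto simp: abs_less_iff)
    then show "\<exists>q'\<in>\<rat> \<inter> {x..1}. w q' < w q + 1 / Suc k"
      using q' by blast
  }
  assume *: "\<forall>q\<in>\<rat> \<inter> {0..x}. \<forall>k::nat. \<exists>q'\<in>\<rat> \<inter> {x..1}. w q' < w q + 1 / Suc k"
  obtain s where s: "s \<in> {x..1}" "\<And>u. u \<in> {x..1} \<Longrightarrow> w s \<le> w u"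
    using continuous_attains_inf[OF compact_Icc _ wx(2)] x by auto
  have Rat: "w s \<le> w q" if q: "q \<in> \<rat> \<inter> {0..x}" for q
  proof (rule ccontr)
    assume "\<not> w s \<le> w q"
    then obtain k :: nat where "1 / Suc k < w s - w q"
      using reals_Archimedean[of "w s - w q"] by (auto simp: inverse_eq_divide)
    moreover obtain q' where "q' \<in> {x..1}" "w q' < w q + 1 / Suc k"
      using * q by blast
    ultimately show False
      using s(2)[of q'] by simp
  qed
  have "w s \<le> w u" if u: "u \<in> {0..1}" for u
  proof (cases "u \<le> x")
    case True
    show ?thesis
    proof (rule field_le_epsilon)
      fix e :: real assume "0 < e"
      with True u obtain q where "q \<in> \<rat> \<inter> {0..x}" "\<bar>w q - w u\<bar> < e"
        using continuous_on_approx_Rats[OF wx(1) x(1), of u e] by auto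
      then show "w s \<le> w u + e"
        using Rat[of q] by (auto simp: abs_less_iff)
    qed
  next
    case False
    then show ?thesis using s u by auto
  qed
  then have "s \<le> \<alpha>"
    using s x by (intro \<alpha>(3)) auto
  then show "x \<le> \<alpha>" using s by auto
qed

text \<open>The functional only compares values of the path with each other, so subtracting
  \<open>B 0\<close> changes nothing. The last argmin is recovered as the supremum of the rationals
  below it.\<close>

lemma argmin_process_eq_functional:
  assumes cont: "continuous_on {0..} (\<lambda>t. B t \<omega>)" and "0 \<le> t"
  shows "argmin_process B t \<omega> = argmin_functional t (\<lambda>r. B r \<omega> - B 0 \<omega>)"
proof -
  let ?w = "\<lambda>s. B (t + s) \<omega>"
  define \<alpha> where "\<alpha> = argmin_process B t \<omega>"
  have w: "continuous_on {0..1} ?w"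
    using \<open>0 \<le> t\<close> by (intro continuous_on_compose2[OF cont]) (auto intro!: continuous_intros)
  have \<alpha>: "0 \<le> \<alpha>" "\<alpha> \<le> 1"
    using last_argmin(1)[OF w] unfolding \<alpha>_def argmin_process_def by auto
  have "argmin_functional t (\<lambda>r. B r \<omega> - B 0 \<omega>) = (SUP x\<in>\<rat> \<inter> {0<..<1}. if x \<le> \<alpha> then x else 0)"
    unfolding argmin_functional_def \<alpha>_def argmin_process_def
    by (intro SUP_cong refl if_cong) (use le_last_argmin_iff[OF w] in \<open>auto simp: algebra_simps\<close>)
  \<comment> \<open>The default value 0 does no harm because 0 \<le> \<alpha>, and it gives the
    right result when \<alpha> = 0 and no \<open>x\<close> qualifies.\<close>
  also have "\<dots> = \<alpha>"
  proof (rule cSup_eq_non_empty)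
    have "(1/2::real) \<in> \<rat> \<inter> {0<..<1}" by simp
    then show "(\<lambda>x. if x \<le> \<alpha> then x else 0) ` (\<rat> \<inter> {0<..<1}) \<noteq> {}" by blast
  next
    fix y assume y: "\<And>x. x \<in> (\<lambda>x. if x \<le> \<alpha> then x else 0) ` (\<rat> \<inter> {0<..<1}) \<Longrightarrow> x \<le> y"
    have *: "(if x \<le> \<alpha> then x else 0) \<le> y" if "x \<in> \<rat> \<inter> {0<..<1}" for x
      using that by (intro y imageI)
    have "0 \<le> y" using *[of "1/2"] by (auto split: if_splits)
    show "\<alpha> \<le> y"
    proof (rule ccontr)
      assume "\<not> \<alpha> \<le> y"
      then obtain x where "x \<in> \<rat>" "y < x" "x < \<alpha>"
        using Rats_dense_in_real[of y \<alpha>] by auto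
      with *[of x] \<alpha> \<open>0 \<le> y\<close> show False by auto
    qed
  qed (use \<alpha> in auto)
  finally show ?thesis by (simp add: \<alpha>_def)
qed

text \<open>The supremum and all quantifiers range over countable sets; this is the gain from using
  rational times only.\<close>

lemma measurable_argmin_functional:
  assumes Q: "(\<lambda>q. j + q) ` (\<rat> \<inter> {0..1}) \<subseteq> Q"
  shows "argmin_functional j \<in> borel_measurable (PiM Q (\<lambda>_. borel))"
proof -
  have [measurable]: "(\<lambda>w. w (j + q)) \<in> borel_measurable (PiM Q (\<lambda>_. borel :: real measure))"
    if "q \<in> \<rat>" "0 \<le> q" "q \<le> 1" for q
    using that Q by (intro measurable_component_singleton) auto
  have "Measurable.pred (PiM Q (\<lambda>_. borel :: real measure))
    (\<lambda>w. \<forall>q\<in>\<rat> \<inter> {0..x}. \<forall>k::nat. \<exists>q'\<in>\<rat> \<inter> {x..1}. w (j + q') < w (j + q) + 1 / Suc k)"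
    if "0 < x" "x < 1" for x
    using that countable_rat
    by (intro measurable_pred_countable pred_intros_countable borel_measurable_pred_less
      borel_measurable_add borel_measurable_const countable_Int1) auto
  then show ?thesis
    unfolding argmin_functional_def
    by (intro borel_measurable_cSUP measurable_If borel_measurable_const bdd_aboveI2[where M = 1] countable_Int1 countable_rat)
       auto
qed

text \<open>Points of the product space over \<open>Q\<close> carry no information off
  \<open>Q\<close>, so it matters that the functional looks at times in \<open>Q\<close>
  only.\<close>

lemma argmin_process_eq_functional_restrict:
  assumes cont: "continuous_on {0..} (\<lambda>t. B t \<omega>)" and "0 \<le> t"
    and Q: "(\<lambda>q. t + q) ` (\<rat> \<inter> {0..1}) \<subseteq> Q"
  shows "argmin_process B t \<omega> = argmin_functional t (\<lambda>r\<in>Q. B r \<omega> - B 0 \<omega>)"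
proof -
  have "t + q \<in> Q" if "q \<in> \<rat>" "0 \<le> q" "q \<le> 1" for q
    using that Q by auto
  then show ?thesis
    unfolding argmin_process_eq_functional[where B = B, OF cont \<open>0 \<le> t\<close>] argmin_functional_def
    by (intro SUP_cong refl if_cong ball_cong all_cong bex_cong) auto
qed

section \<open>Stationarity of the argmin process\<close>

lemma stationary_argmin_process:
  assumes B: "standard_brownian_motion M B"
  shows "stationary_process M (argmin_process B)"
  unfolding stationary_process_def
proof (intro conjI allI impI)
  interpret standard_brownian_motion M B by fact
  fix t :: real assume t: "0 \<le> t"
  define Q where "Q = (\<lambda>q. t + q) ` (\<rat> \<inter> {0..1})"
  have Q: "Q \<subseteq> {0..}" using t by (auto simp: Q_def)
  have "(\<lambda>\<omega>. argmin_functional t (\<lambda>r\<in>Q. B r \<omega> - B 0 \<omega>)) \<in> borel_measurable M"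
    by (intro measurable_compose[OF measurable_brownian_path[OF B Q]] measurable_argmin_functional)
      (simp add: Q_def)
  then show "argmin_process B t \<in> borel_measurable M"
    using argmin_process_eq_functional_restrict[where B = B and Q = Q, OF continuous_paths t]
    by (simp add: Q_def cong: measurable_cong)
next
  interpret standard_brownian_motion M B by fact
  fix h :: real and J :: "real set"
  assume h: "0 \<le> h" and J: "finite J \<and> J \<subseteq> {0..}"
  define B' where "B' = (\<lambda>t \<omega>. B (h + t) \<omega> - B h \<omega>)"
  have B': "standard_brownian_motion M B'"
    unfolding B'_def using B h by (rule standard_brownian_motion_shift)
  \<comment> \<open>All times that the argmin functionals for the times in \<open>J\<close> look
    at.\<close>
  define Q where "Q = (\<lambda>(j, q). j + q) ` (J \<times> (\<rat> \<inter> {0..1}))"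
  have Q: "Q \<subseteq> {0..}" using J by (auto simp: Q_def)
  have jQ: "(\<lambda>q. j + q) ` (\<rat> \<inter> {0..1}) \<subseteq> Q" if "j \<in> J" for j
    using that by (auto simp: Q_def)
  define \<Phi> where "\<Phi> = (\<lambda>w. \<lambda>j\<in>J. argmin_functional j w)"
  have \<Phi>: "\<Phi> \<in> PiM Q (\<lambda>_. borel) \<rightarrow>\<^sub>M PiM J (\<lambda>_. borel)"
    unfolding \<Phi>_def by (intro measurable_restrict measurable_argmin_functional jQ)
  \<comment> \<open>Both sides read the same stretch of the path; the constants \<open>B 0\<close>
    and \<open>B h\<close> cancel in every comparison.\<close>
  have shift: "argmin_process B (j + h) \<omega> = argmin_process B' j \<omega>" if "\<omega> \<in> space M" "j \<in> J" for \<omega> j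
  proof -
    interpret B': standard_brownian_motion M B' by (rule B')
    have "argmin_process B (j + h) \<omega> = argmin_functional (j + h) (\<lambda>r. B r \<omega> - B 0 \<omega>)"
      "argmin_process B' j \<omega> = argmin_functional j (\<lambda>r. B' r \<omega> - B' 0 \<omega>)"
      using that h J by (auto intro!: argmin_process_eq_functional continuous_paths B'.continuous_paths)
    then show ?thesis
      by (simp add: argmin_functional_def B'_def algebra_simps)
  qed
  \<comment> \<open>The finite-dimensional law is the image of the path law on \<open>Q\<close>
    under the fixed map \<Phi>, hence the same for all Brownian motions on \<open>M\<close>.\<close>
  have repr: "distr M (PiM J (\<lambda>_. borel)) (\<lambda>\<omega>. \<lambda>j\<in>J. argmin_process W j \<omega>) =
    distr (distr M (PiM Q (\<lambda>_. borel)) (\<lambda>\<omega>. \<lambda>r\<in>Q. W r \<omega> - W 0 \<omega>)) (PiM J (\<lambda>_. borel)) \<Phi>"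
    if W: "standard_brownian_motion M W" for W
  proof -
    interpret W: standard_brownian_motion M W by fact
    have "(\<lambda>j\<in>J. argmin_process W j \<omega>) = \<Phi> (\<lambda>r\<in>Q. W r \<omega> - W 0 \<omega>)" if "\<omega> \<in> space M" for \<omega>
      unfolding \<Phi>_def using J that
      by (intro restrict_ext argmin_process_eq_functional_restrict W.continuous_paths jQ) auto
    then show ?thesis
      by (subst distr_distr[OF \<Phi> measurable_brownian_path[OF W Q]]) (intro distr_cong, simp_all)
  qed
  have "distr M (PiM J (\<lambda>_. borel)) (\<lambda>\<omega>. \<lambda>j\<in>J. argmin_process B (j + h) \<omega>) =
    distr M (PiM J (\<lambda>_. borel)) (\<lambda>\<omega>. \<lambda>j\<in>J. argmin_process B' j \<omega>)"
    by (intro distr_cong restrict_ext shift) simp_all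
  then show "distr M (PiM J (\<lambda>_. borel)) (\<lambda>\<omega>. \<lambda>j\<in>J. argmin_process B (j + h) \<omega>) =
    distr M (PiM J (\<lambda>_. borel)) (\<lambda>\<omega>. \<lambda>j\<in>J. argmin_process B j \<omega>)"
    by (simp add: repr[OF B] repr[OF B'] distr_brownian_path[OF B B' Q])
qed

section \<open>Arcsine law for symmetric walks\<close>

text \<open>These are the coefficients of (1 - x) powr (-1/2), that is
  \<open>(2 * k choose k) / 4 ^ k\<close>.\<close>

definition arcsine_weight :: "nat \<Rightarrow> real" where
  "arcsine_weight k = pochhammer (1/2) k / fact k"

lemma arcsine_weight_0 [simp]: "arcsine_weight 0 = 1"
  by (simp add: arcsine_weight_def)

lemma arcsine_weight_nonneg: "0 \<le> arcsine_weight k"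
  by (simp add: arcsine_weight_def pochhammer_nonneg)

text \<open>Squaring the generating function gives 1 / (1 - x), whose coefficients are all 1. In
  finite form this is Vandermonde's identity for -1/2 + -1/2 = -1.\<close>

lemma sum_arcsine_weight: "(\<Sum>k\<le>n. arcsine_weight k * arcsine_weight (n - k)) = 1"
proof -
  have "arcsine_weight k = (-1) ^ k * ((-1/2) gchoose k)" for k
    by (simp add: arcsine_weight_def gbinomial_pochhammer flip: power_mult_distrib)
  then have "(\<Sum>k\<le>n. arcsine_weight k * arcsine_weight (n - k)) =
    (\<Sum>k\<in>{0..n}. (-1) ^ n * (((-1/2) gchoose k) * ((-1/2) gchoose (n - k))))"
    by (intro sum.cong) (auto simp: power_add[symmetric] atMost_atLeast0 mult_ac)
  also have "\<dots> = (-1) ^ n * ((-1) gchoose n)"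
    using gbinomial_Vandermonde[of "-1/2::real" "-1/2" n] by (simp flip: sum_distrib_left)
  also have "\<dots> = 1"
    by (simp add: gbinomial_pochhammer pochhammer_fact[symmetric] flip: power_mult_distrib)
  finally show ?thesis .
qed

text \<open>Up to a factor tending to 1 this is Gauss's limit for the reciprocal Gamma function at
  1/2, where Gamma takes the value \<open>sqrt pi\<close>.\<close>

lemma arcsine_weight_asymp: "(\<lambda>n. sqrt n * arcsine_weight n) \<longlonglongrightarrow> 1 / sqrt pi"
proof -
  have "rGamma_series (1/2::real) \<longlonglongrightarrow> 1 / sqrt pi"
    using rGamma_series_LIMSEQ[of "1/2::real"] by (simp add: rGamma_inverse_Gamma Gamma_one_half_real inverse_eq_divide)
  \<comment> \<open>\<open>rGamma_series\<close> has one more Pochhammer factor,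
    \<open>n + 1/2\<close>, and divides by \<open>sqrt n\<close>; the correction cancels the former
    and turns the division into a multiplication.\<close>
  then have "(\<lambda>n. rGamma_series (1/2::real) n * (n / (n + 1/2))) \<longlonglongrightarrow> 1 / sqrt pi * 1"
    by (rule tendsto_mult) real_asymp
  moreover have "\<forall>\<^sub>F n in sequentially. rGamma_series (1/2::real) n * (n / (n + 1/2)) = sqrt n * arcsine_weight n"
  proof (rule eventually_mono[OF eventually_gt_at_top[of 0]])
    fix n :: nat assume "0 < n"
    have "exp (1 / 2 * ln (real n)) = sqrt n"
      using \<open>0 < n\<close> by (simp add: powr_def flip: powr_half_sqrt)
    then have "rGamma_series (1/2::real) n * (n / (n + 1/2)) =
      pochhammer (1/2) n * (1/2 + n) / (fact n * sqrt n) * (sqrt n * sqrt n / (n + 1/2))"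
      by (simp add: rGamma_series_def pochhammer_Suc)
    also have "\<dots> = sqrt n * arcsine_weight n"
    proof -
      have "p * d / (f * s) * (s * s / d) = s * (p / f)" if "s \<noteq> 0" "d \<noteq> 0" "f \<noteq> 0" for p d f s :: real
        using that by (simp add: field_simps)
      from this[of "sqrt n" "n + 1/2" "fact n" "pochhammer (1/2) n"] show ?thesis
        using \<open>0 < n\<close> by (simp add: arcsine_weight_def add.commute add_nonneg_eq_0_iff)
    qed
    finally show "rGamma_series (1/2::real) n * (n / (n + 1/2)) = sqrt n * arcsine_weight n" .
  qed
  ultimately show ?thesis
    by (auto intro: Lim_transform_eventually)
qed

text \<open>For \<open>m > 0\<close> the value \<open>p m\<close> occurs only in the two outer
  terms, each time multiplied by \<open>p 0 = 1\<close>, while the inner terms involve smaller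
  indices. So the identities determine \<open>p\<close> recursively. They are assumed only up to
  \<open>n\<close> because a walk with \<open>n\<close> steps provides no more.\<close>

lemma convolution_square_unique:
  fixes p q :: "nat \<Rightarrow> real"
  assumes p: "\<And>m. m \<le> n \<Longrightarrow> (\<Sum>k\<le>m. p k * p (m - k)) = 1"
    and q: "\<And>m. m \<le> n \<Longrightarrow> (\<Sum>k\<le>m. q k * q (m - k)) = 1"
    and "p 0 = 1" "q 0 = 1" "m \<le> n"
  shows "p m = q m"
  using \<open>m \<le> n\<close>
proof (induction m rule: less_induct)
  case (less m)
  show ?case
  proof (cases "m = 0")
    case False
    have "(\<Sum>k\<le>m. r k * r (m - k)) = 2 * r m + (\<Sum>k\<in>{1..<m}. r k * r (m - k))" if "r 0 = 1" for r :: "nat \<Rightarrow> real"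
    proof -
      have "{..m} = insert 0 (insert m {1..<m})" using False by auto
      then show ?thesis using False that by simp
    qed
    then have "2 * p m + (\<Sum>k\<in>{1..<m}. p k * p (m - k)) = 2 * q m + (\<Sum>k\<in>{1..<m}. q k * q (m - k))"
      using p[OF less.prems] q[OF less.prems] assms(3,4) by simp
    moreover have "(\<Sum>k\<in>{1..<m}. p k * p (m - k)) = (\<Sum>k\<in>{1..<m}. q k * q (m - k))"
      using less by (intro sum.cong) auto
    ultimately show ?thesis by simp
  qed (use assms in simp)
qed

section \<open>Last minima of finite sequences\<close>

definition is_last_min :: "(nat \<Rightarrow> real) \<Rightarrow> nat \<Rightarrow> nat \<Rightarrow> bool" where
  "is_last_min s n k \<longleftrightarrow> k \<le> n \<and> (\<forall>i<k. s k \<le> s i) \<and> (\<forall>i\<in>{k<..n}. s k < s i)"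

lemma is_last_min_le: "is_last_min s n k \<Longrightarrow> i \<le> n \<Longrightarrow> s k \<le> s i"
  unfolding is_last_min_def by (metis greaterThanAtMost_iff linorder_neqE_nat order.refl order.strict_implies_order)

lemma is_last_min_unique: "is_last_min s n k \<Longrightarrow> is_last_min s n k' \<Longrightarrow> k = k'"
  unfolding is_last_min_def by (metis greaterThanAtMost_iff linorder_neqE_nat not_less)

text \<open>The largest minimiser qualifies, since a later index with no larger value would itself
  be a minimiser.\<close>

lemma is_last_min_exists: "\<exists>k. is_last_min s n k"
proof -
  define K where "K = {k. k \<le> n \<and> (\<forall>i\<le>n. s k \<le> s i)}"
  have "Min (s ` {..n}) \<in> s ` {..n}"
    by (intro Min_in) auto
  then obtain k where k: "Min (s ` {..n}) = s k" "k \<in> {..n}"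
    by (rule imageE)
  have "k \<in> K"
    using k(2) by (simp add: K_def flip: k(1))
  then have "K \<noteq> {}" by blast
  moreover have "finite K" by (auto simp: K_def)
  ultimately have *: "Max K \<in> K" "\<And>j. j \<in> K \<Longrightarrow> j \<le> Max K" by (auto intro: Max_in)
  have "s (Max K) < s i" if "Max K < i" "i \<le> n" for i
  proof (rule ccontr)
    assume "\<not> s (Max K) < s i"
    then have "i \<in> K" using *(1) that unfolding K_def by (auto intro: order_trans)
    then show False using *(2) that by force
  qed
  with * show ?thesis
    unfolding is_last_min_def K_def by (intro exI[of _ "Max K"]) (auto simp: K_def)
qed

section \<open>Minima of symmetric walks\<close>

lemma (in prob_space) indep_vars_reindex:
  assumes X: "indep_vars N X K" and f: "inj_on f I" "f ` I \<subseteq> K"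
  shows "indep_vars (\<lambda>i. N (f i)) (\<lambda>i. X (f i)) I"
proof -
  have "indep_sets (\<lambda>i. F (f i)) I" if F: "indep_sets F K" for F :: "'b \<Rightarrow> 'a set set"
  proof (rule indep_setsI)
    show "F (f i) \<subseteq> events" if "i \<in> I" for i
      using F f that by (auto simp: indep_sets_def)
    fix A J assume J: "J \<noteq> {}" "J \<subseteq> I" "finite J" and A: "\<forall>j\<in>J. A j \<in> F (f j)"
    have inj: "inj_on f J" using f J by (blast intro: inj_on_subset)
    define A' where "A' = A \<circ> the_inv_into J f"
    have A': "A' (f j) = A j" if "j \<in> J" for j
      using that inj by (simp add: A'_def the_inv_into_f_f)
    have "prob (\<Inter>j\<in>f ` J. A' j) = (\<Prod>j\<in>f ` J. prob (A' j))"
      using F J f A by (intro indep_setsD) (auto simp: A')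
    then show "prob (\<Inter>j\<in>J. A j) = (\<Prod>j\<in>J. prob (A j))"
      using inj by (simp add: prod.reindex A' cong: INF_cong)
  qed
  then show ?thesis
    using X f unfolding indep_vars_def2 by auto
qed

text \<open>The single law \<open>D\<close> encodes both identical distribution and symmetry of the
  steps. By \<open>no_ties\<close> the positions at two different times differ almost surely, so
  weak and strict inequalities between them are equally likely.\<close>

locale symmetric_walk = prob_space M for M :: "'a measure" +
  fixes X :: "nat \<Rightarrow> 'a \<Rightarrow> real" and n :: nat and D :: "real measure"
  assumes indep_X: "indep_vars (\<lambda>_. borel) X {..<n}"
    and distr_X: "\<And>i. i < n \<Longrightarrow> distr M borel (X i) = D"
    and symmetric_X: "\<And>i. i < n \<Longrightarrow> distr M borel (\<lambda>\<omega>. - X i \<omega>) = D"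
    and no_ties: "\<And>i j. i < j \<Longrightarrow> j \<le> n \<Longrightarrow> AE \<omega> in M. (\<Sum>l\<in>{i..<j}. X l \<omega>) \<noteq> 0"
begin

lemma measurable_X: "i < n \<Longrightarrow> X i \<in> borel_measurable M"
  using indep_X by (auto simp: indep_vars_def)

definition stay_positive :: "nat \<Rightarrow> real" where
  "stay_positive m = prob {\<omega> \<in> space M. \<forall>i\<in>{1..m}. 0 < (\<Sum>j<i. X j \<omega>)}"

text \<open>Events about partial sums depend only on the joint law of the steps, which independence
  and \<open>D\<close> determine. This serves for shifted steps and for reversed, negated
  ones.\<close>

lemma prob_partial_sums_cong:
  assumes Y: "indep_vars (\<lambda>_. borel) Y {..<m}" "\<And>i. i < m \<Longrightarrow> distr M borel (Y i) = D" and "m \<le> n"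
    and P: "\<And>i. i \<in> {1..m} \<Longrightarrow> Measurable.pred borel (P i)"
  shows "prob {\<omega> \<in> space M. \<forall>i\<in>{1..m}. P i (\<Sum>j<i. Y j \<omega>)} =
    prob {\<omega> \<in> space M. \<forall>i\<in>{1..m}. P i (\<Sum>j<i. X j \<omega>)}"
proof -
  let ?S = "{x \<in> space (PiM {..<m} (\<lambda>_. borel)). \<forall>i\<in>{1..m}. P i (\<Sum>j<i. x j)}"
  have "Measurable.pred (PiM {..<m} (\<lambda>_. borel)) (\<lambda>x. P i (\<Sum>j<i. x j))" if "i \<in> {1..m}" for i
    using that by (intro measurable_compose[OF _ P] borel_measurable_sum measurable_component_singleton) auto
  then have S: "?S \<in> sets (PiM {..<m} (\<lambda>_. borel))"
    by measurable
  have eq: "prob {\<omega> \<in> space M. \<forall>i\<in>{1..m}. P i (\<Sum>j<i. Z j \<omega>)} =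
    measure (distr M (PiM {..<m} (\<lambda>_. borel)) (\<lambda>\<omega>. \<lambda>i\<in>{..<m}. Z i \<omega>)) ?S"
    if "\<And>i. i < m \<Longrightarrow> Z i \<in> borel_measurable M" for Z :: "nat \<Rightarrow> 'a \<Rightarrow> real"
  proof -
    have rv: "(\<lambda>\<omega>. \<lambda>i\<in>{..<m}. Z i \<omega>) \<in> M \<rightarrow>\<^sub>M PiM {..<m} (\<lambda>_. borel)"
      using that by (intro measurable_restrict) auto
    have sum: "(\<Sum>j<i. (\<lambda>i\<in>{..<m}. Z i \<omega>) j) = (\<Sum>j<i. Z j \<omega>)" if "i \<in> {1..m}" for i \<omega>
      using that by (intro sum.cong) auto
    have "(\<lambda>\<omega>. \<lambda>i\<in>{..<m}. Z i \<omega>) -` ?S \<inter> space M = {\<omega> \<in> space M. \<forall>i\<in>{1..m}. P i (\<Sum>j<i. Z j \<omega>)}"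
      using measurable_space[OF rv] sum by (auto simp del: restrict_apply)
    then show ?thesis
      using rv S by (simp add: measure_distr)
  qed
  have "indep_vars (\<lambda>_. borel) X {..<m}"
    using \<open>m \<le> n\<close> by (intro indep_vars_subset[OF indep_X]) auto
  then have "distr M (PiM {..<m} (\<lambda>_. borel)) (\<lambda>\<omega>. \<lambda>i\<in>{..<m}. Y i \<omega>) =
    distr M (PiM {..<m} (\<lambda>_. borel)) (\<lambda>\<omega>. \<lambda>i\<in>{..<m}. X i \<omega>)"
    using Y distr_X \<open>m \<le> n\<close> by (intro distr_indep_vars_cong) auto
  moreover have "Y i \<in> borel_measurable M" if "i < m" for i
    using Y that by (auto simp: indep_vars_def)
  ultimately show ?thesis
    using eq[of Y] eq[of X] measurable_X \<open>m \<le> n\<close> by simp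
qed

text \<open>The steps from \<open>k\<close> on are again independent with law \<open>D\<close>, so
  the walk restarts at \<open>k\<close>.\<close>

lemma prob_future_above:
  assumes "k \<le> m" "m \<le> n"
  shows "prob {\<omega> \<in> space M. \<forall>i\<in>{k<..m}. 0 < (\<Sum>j\<in>{k..<i}. X j \<omega>)} = stay_positive (m - k)"
proof -
  have "indep_vars (\<lambda>_. borel) (\<lambda>i. X (k + i)) {..<m - k}"
    using assms by (intro indep_vars_reindex[OF indep_X]) auto
  then have "prob {\<omega> \<in> space M. \<forall>i\<in>{1..m-k}. 0 < (\<Sum>j<i. X (k + j) \<omega>)} = stay_positive (m - k)"
    unfolding stay_positive_def using assms distr_X by (intro prob_partial_sums_cong) auto
  moreover have "(\<forall>i\<in>{k<..m}. 0 < (\<Sum>j\<in>{k..<i}. X j \<omega>)) \<longleftrightarrow> (\<forall>i\<in>{1..m-k}. 0 < (\<Sum>j<i. X (k + j) \<omega>))" for \<omega>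
  proof -
    have "{k<..m} = (+) k ` {1..m-k}"
      using assms by (simp add: atLeastSucAtMost_greaterThanAtMost)
    moreover have "(\<Sum>j\<in>{k..<k+i}. X j \<omega>) = (\<Sum>j<i. X (k + j) \<omega>)" for i
      using sum.shift_bounds_nat_ivl[of "\<lambda>j. X j \<omega>" 0 k i] by (simp add: atLeast0LessThan add.commute)
    ultimately show ?thesis by (simp del: image_add_atLeastAtMost)
  qed
  ultimately show ?thesis by simp
qed

text \<open>Reversing the order and the sign of the steps turns the past of the minimum into a future.\<close>

lemma prob_past_above:
  assumes "k \<le> n"
  shows "prob {\<omega> \<in> space M. \<forall>i<k. (\<Sum>j\<in>{i..<k}. X j \<omega>) \<le> 0} = stay_positive k"
proof -
  have "indep_vars (\<lambda>_. borel) (\<lambda>i. X (k - 1 - i)) {..<k}"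
    using assms by (intro indep_vars_reindex[OF indep_X]) (auto simp: inj_on_def)
  then have "indep_vars (\<lambda>_. borel) (\<lambda>i \<omega>. - X (k - 1 - i) \<omega>) {..<k}"
    by (rule indep_vars_compose2) simp
  then have "prob {\<omega> \<in> space M. \<forall>i\<in>{1..k}. 0 \<le> (\<Sum>j<i. - X (k - 1 - j) \<omega>)} =
    prob {\<omega> \<in> space M. \<forall>i\<in>{1..k}. 0 \<le> (\<Sum>j<i. X j \<omega>)}"
    using assms symmetric_X by (intro prob_partial_sums_cong) auto
  moreover have "(\<forall>i<k. (\<Sum>j\<in>{i..<k}. X j \<omega>) \<le> 0) \<longleftrightarrow> (\<forall>i\<in>{1..k}. 0 \<le> (\<Sum>j<i. - X (k - 1 - j) \<omega>))" for \<omega>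
  proof -
    have "{..<k} = (\<lambda>i. k - i) ` {1..k}"
    proof safe
      fix i assume "i < k"
      then show "i \<in> (\<lambda>i. k - i) ` {1..k}"
        by (intro image_eqI[of _ _ "k - i"]) auto
    qed auto
    then have "(\<forall>i<k. (\<Sum>j\<in>{i..<k}. X j \<omega>) \<le> 0) \<longleftrightarrow> (\<forall>i\<in>{1..k}. (\<Sum>j\<in>{k-i..<k}. X j \<omega>) \<le> 0)"
      unfolding lessThan_iff[symmetric] Ball_def[symmetric] by simp
    moreover have "(\<Sum>j<i. - X (k - 1 - j) \<omega>) = - (\<Sum>j\<in>{k-i..<k}. X j \<omega>)" if "i \<in> {1..k}" for i
      unfolding sum_negf using that
      by (intro arg_cong[where f = uminus] sum.reindex_bij_witness[of _ "\<lambda>j. k - 1 - j" "\<lambda>j. k - 1 - j"]) auto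
    ultimately show ?thesis by simp
  qed
  \<comment> \<open>Reversal yields a weak inequality where \<open>stay_positive\<close> has a
    strict one; by \<open>no_ties\<close> the two events differ by a null set.\<close>
  moreover have "prob {\<omega> \<in> space M. \<forall>i\<in>{1..k}. 0 \<le> (\<Sum>j<i. X j \<omega>)} = stay_positive k"
    unfolding stay_positive_def
  proof (rule measure_eq_AE)
    have "AE \<omega> in M. \<forall>i\<in>{1..k}. (\<Sum>j\<in>{0..<i}. X j \<omega>) \<noteq> 0"
      using assms by (intro AE_finite_allI no_ties) auto
    then show "AE \<omega> in M. \<omega> \<in> {\<omega> \<in> space M. \<forall>i\<in>{1..k}. 0 \<le> (\<Sum>j<i. X j \<omega>)} \<longleftrightarrow>
      \<omega> \<in> {\<omega> \<in> space M. \<forall>i\<in>{1..k}. 0 < (\<Sum>j<i. X j \<omega>)}"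
      by eventually_elim (auto simp: atLeast0LessThan less_le)
    have [measurable]: "(\<lambda>\<omega>. \<Sum>j<i. X j \<omega>) \<in> borel_measurable M" if "i \<in> {1..k}" for i
      using assms that measurable_X by (intro borel_measurable_sum) auto
    show "{\<omega> \<in> space M. \<forall>i\<in>{1..k}. 0 \<le> (\<Sum>j<i. X j \<omega>)} \<in> events"
      "{\<omega> \<in> space M. \<forall>i\<in>{1..k}. 0 < (\<Sum>j<i. X j \<omega>)} \<in> events"
      by measurable
  qed
  ultimately show ?thesis by simp
qed

text \<open>Taking differences with the value at \<open>k\<close> separates a condition on the steps
  before \<open>k\<close> from one on the steps from \<open>k\<close> on, ready for
  independence.\<close>

lemma is_last_min_walk_iff:
  "is_last_min (\<lambda>i. \<Sum>j<i. X j \<omega>) m k \<longleftrightarrow> k \<le> m \<and> (\<forall>i<k. (\<Sum>j\<in>{i..<k}. X j \<omega>) \<le> 0) \<and>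
    (\<forall>i\<in>{k<..m}. 0 < (\<Sum>j\<in>{k..<i}. X j \<omega>))"
proof -
  have concat: "(\<Sum>j<b. X j \<omega>) = (\<Sum>j<a. X j \<omega>) + (\<Sum>j\<in>{a..<b}. X j \<omega>)" if "a \<le> b" for a b
    using that sum.atLeastLessThan_concat[of 0 a b "\<lambda>j. X j \<omega>"] by (simp add: atLeast0LessThan)
  have "(\<Sum>j\<in>{i..<k}. X j \<omega>) \<le> 0 \<longleftrightarrow> (\<Sum>j<k. X j \<omega>) \<le> (\<Sum>j<i. X j \<omega>)" if "i < k" for i k
    using concat[OF less_imp_le[OF that]] by linarith
  moreover have "0 < (\<Sum>j\<in>{k..<i}. X j \<omega>) \<longleftrightarrow> (\<Sum>j<k. X j \<omega>) < (\<Sum>j<i. X j \<omega>)" if "k < i" for i k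
    using concat[OF less_imp_le[OF that]] by linarith
  ultimately show ?thesis
    unfolding is_last_min_def by auto
qed

lemma sets_is_last_min:
  assumes "m \<le> n"
  shows "{\<omega> \<in> space M. is_last_min (\<lambda>i. \<Sum>j<i. X j \<omega>) m k} \<in> events"
proof (cases "k \<le> m")
  case True
  have [measurable]: "(\<lambda>\<omega>. \<Sum>j<i. X j \<omega>) \<in> borel_measurable M" if "i \<le> m" for i
    using assms that measurable_X by (intro borel_measurable_sum) auto
  have "is_last_min s m k \<longleftrightarrow> (\<forall>i\<in>{..<k}. s k \<le> s i) \<and> (\<forall>i\<in>{k<..m}. s k < s i)" for s
    using True by (auto simp: is_last_min_def)
  then show ?thesis
    using True by simp measurable
qed (simp add: is_last_min_def)

text \<open>The past condition \<open>S\<close> and the future condition \<open>T\<close> concern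
  disjoint blocks of steps, so their probabilities multiply.\<close>

lemma prob_is_last_min_stay_positive:
  assumes "k \<le> m" "m \<le> n"
  shows "prob {\<omega> \<in> space M. is_last_min (\<lambda>i. \<Sum>j<i. X j \<omega>) m k} = stay_positive k * stay_positive (m - k)"
proof -
  let ?P = "\<lambda>I. PiM I (\<lambda>_. borel :: real measure)"
  let ?X = "\<lambda>I \<omega>. \<lambda>i\<in>I. X i \<omega>"
  define S where "S = {x \<in> space (?P {..<k}). \<forall>i\<in>{..<k}. (\<Sum>j\<in>{i..<k}. x j) \<le> 0}"
  define T where "T = {x \<in> space (?P {k..<m}). \<forall>i\<in>{k<..m}. 0 < (\<Sum>j\<in>{k..<i}. x j)}"
  have [measurable]: "(\<lambda>x. \<Sum>j\<in>{i..<k}. x j) \<in> borel_measurable (?P {..<k})" for i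
    by (intro borel_measurable_sum measurable_component_singleton) auto
  have [measurable]: "(\<lambda>x. \<Sum>j\<in>{k..<i}. x j) \<in> borel_measurable (?P {k..<m})" if "i \<in> {k<..m}" for i
    using that by (intro borel_measurable_sum measurable_component_singleton) auto
  have S: "S \<in> sets (?P {..<k})" unfolding S_def by measurable
  have T: "T \<in> sets (?P {k..<m})" unfolding T_def by measurable
  have ind: "indep_var (?P {..<k}) (?X {..<k}) (?P {k..<m}) (?X {k..<m})"
    using assms by (intro indep_var_restrict[OF indep_X]) auto
  have rv: "?X {..<k} \<in> M \<rightarrow>\<^sub>M ?P {..<k}" "?X {k..<m} \<in> M \<rightarrow>\<^sub>M ?P {k..<m}"
    using indep_var_rv1[OF ind] indep_var_rv2[OF ind] .
  have sumS: "(\<Sum>j\<in>{i..<k}. ?X {..<k} \<omega> j) = (\<Sum>j\<in>{i..<k}. X j \<omega>)" for i \<omega>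
    by (intro sum.cong) auto
  have sumT: "(\<Sum>j\<in>{k..<i}. ?X {k..<m} \<omega> j) = (\<Sum>j\<in>{k..<i}. X j \<omega>)" if "i \<in> {k<..m}" for i \<omega>
    using that by (intro sum.cong) auto
  have preS: "?X {..<k} -` S \<inter> space M = {\<omega> \<in> space M. \<forall>i<k. (\<Sum>j\<in>{i..<k}. X j \<omega>) \<le> 0}"
    using measurable_space[OF rv(1)] by (auto simp: S_def sumS simp del: restrict_apply)
  have preT: "?X {k..<m} -` T \<inter> space M = {\<omega> \<in> space M. \<forall>i\<in>{k<..m}. 0 < (\<Sum>j\<in>{k..<i}. X j \<omega>)}"
    using measurable_space[OF rv(2)] by (auto simp: T_def sumT simp del: restrict_apply)
  have "{\<omega> \<in> space M. is_last_min (\<lambda>i. \<Sum>j<i. X j \<omega>) m k} =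
    (?X {..<k} -` S \<inter> space M) \<inter> (?X {k..<m} -` T \<inter> space M)"
    unfolding preS preT is_last_min_walk_iff using assms by auto
  also have "\<dots> = (\<lambda>\<omega>. (?X {..<k} \<omega>, ?X {k..<m} \<omega>)) -` (S \<times> T) \<inter> space M"
    by auto
  finally show ?thesis
    using indep_varD[OF ind S T] assms by (simp only: preS preT prob_past_above[of k] prob_future_above)
qed

lemma sum_prob_is_last_min:
  assumes "m \<le> n"
  shows "(\<Sum>k\<le>m. prob {\<omega> \<in> space M. is_last_min (\<lambda>i. \<Sum>j<i. X j \<omega>) m k}) = 1"
proof -
  let ?E = "\<lambda>k. {\<omega> \<in> space M. is_last_min (\<lambda>i. \<Sum>j<i. X j \<omega>) m k}"
  have "(\<Sum>k\<le>m. prob (?E k)) = prob (\<Union>k\<le>m. ?E k)"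
    using sets_is_last_min[OF assms] is_last_min_unique
    by (intro finite_measure_finite_Union[symmetric]) (auto simp: disjoint_family_on_def)
  also have "(\<Union>k\<le>m. ?E k) = space M"
  proof safe
    fix \<omega> assume "\<omega> \<in> space M"
    moreover obtain k where "is_last_min (\<lambda>i. \<Sum>j<i. X j \<omega>) m k"
      using is_last_min_exists by blast
    moreover from this have "k \<le> m" by (simp add: is_last_min_def)
    ultimately show "\<omega> \<in> (\<Union>k\<le>m. ?E k)" by blast
  qed
  finally show ?thesis by (simp add: prob_space)
qed

text \<open>\<open>stay_positive\<close> and the arcsine weights both start at 1 and have
  self-convolution 1 at every \<open>m \<le> n\<close>, the former because \<open>m\<close> steps
  have exactly one last minimum; so they agree up to \<open>n\<close>.\<close>

lemma prob_is_last_min: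
  assumes "k \<le> n"
  shows "prob {\<omega> \<in> space M. is_last_min (\<lambda>i. \<Sum>j<i. X j \<omega>) n k} = arcsine_weight k * arcsine_weight (n - k)"
proof -
  have "stay_positive m = arcsine_weight m" if "m \<le> n" for m
  proof (rule convolution_square_unique[OF _ _ _ _ that])
    show "(\<Sum>k\<le>m. stay_positive k * stay_positive (m - k)) = 1" if "m \<le> n" for m
      using sum_prob_is_last_min[OF that] that by (simp add: prob_is_last_min_stay_positive)
    show "stay_positive 0 = 1" by (simp add: stay_positive_def prob_space)
  qed (simp_all add: sum_arcsine_weight)
  then show ?thesis using assms by (simp add: prob_is_last_min_stay_positive)
qed

end

section \<open>Uniqueness of the argmin and convergence along grids\<close>

text \<open>Fatou's lemma for the indicators of \<open>E n\<close>, whose lower limit is 1 almost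
  everywhere on \<open>A\<close>.\<close>

lemma (in prob_space) emeasure_le_liminf:
  assumes A: "A \<in> events" and E: "\<And>n. E n \<in> events"
    and ev: "AE \<omega> in M. \<omega> \<in> A \<longrightarrow> (\<forall>\<^sub>F n in sequentially. \<omega> \<in> E n)"
  shows "emeasure M A \<le> liminf (\<lambda>n. emeasure M (E n))"
proof -
  have "emeasure M A = (\<integral>\<^sup>+\<omega>. indicator A \<omega> \<partial>M)"
    using A by simp
  also have "\<dots> \<le> (\<integral>\<^sup>+\<omega>. liminf (\<lambda>n. indicator (E n) \<omega>) \<partial>M)"
  proof (rule nn_integral_mono_AE)
    show "AE \<omega> in M. (indicator A \<omega> :: ennreal) \<le> liminf (\<lambda>n. indicator (E n) \<omega>)"
      using ev
    proof eventually_elim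
      case (elim \<omega>)
      show ?case
      proof (cases "\<omega> \<in> A")
        case True
        with elim have "\<forall>\<^sub>F n in sequentially. (1::ennreal) \<le> indicator (E n) \<omega>"
          by (auto elim: eventually_mono)
        then show ?thesis
          using True by (auto intro: Liminf_bounded)
      qed simp
    qed
  qed
  also have "\<dots> \<le> liminf (\<lambda>n. \<integral>\<^sup>+\<omega>. indicator (E n) \<omega> \<partial>M)"
    using E by (intro nn_integral_liminf) simp
  finally show ?thesis using E by simp
qed

text \<open>Given \<open>Y = y\<close>, the variable \<open>X\<close> must fall into an interval of
  length \<open>2 * e\<close>, which has mass at most \<open>2 * C * e\<close>; this is integrated
  over the law of \<open>Y\<close>.\<close>

lemma (in prob_space) prob_abs_sum_less_le:
  fixes X Y :: "'a \<Rightarrow> real"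
  assumes ind: "indep_var borel X borel Y" and X: "distributed M lborel X (\<lambda>x. ennreal (f x))"
    and f: "\<And>x. f x \<le> C" and "0 \<le> C" and "0 \<le> e"
  shows "prob {\<omega> \<in> space M. \<bar>X \<omega> + Y \<omega>\<bar> < e} \<le> 2 * C * e"
proof -
  have rv[measurable]: "X \<in> borel_measurable M" "Y \<in> borel_measurable M"
    using indep_var_rv1[OF ind] indep_var_rv2[OF ind] .
  interpret Y: prob_space "distr M borel Y"
    by (rule prob_space_distr) simp
  interpret X: prob_space "distr M borel X"
    by (rule prob_space_distr) simp
  interpret XY: pair_prob_space "distr M borel X" "distr M borel Y" ..
  define A where "A = {z \<in> space (borel \<Otimes>\<^sub>M borel). \<bar>fst z + snd z :: real\<bar> < e}"
  have A: "A \<in> sets (borel \<Otimes>\<^sub>M borel)"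
    unfolding A_def by measurable
  have slice: "emeasure (distr M borel X) ((\<lambda>x. (x, y)) -` A) \<le> ennreal (2 * C * e)" for y
  proof -
    have eq: "(\<lambda>x. (x, y)) -` A = {-y-e<..<-y+e}"
      by (auto simp: A_def space_pair_measure abs_less_iff)
    have "distr M borel X = distr M lborel X"
      by (simp cong: distr_cong)
    then have "emeasure (distr M borel X) {-y-e<..<-y+e} = emeasure (density lborel f) {-y-e<..<-y+e}"
      using X by (simp add: distributed_def)
    also have "\<dots> = (\<integral>\<^sup>+x. ennreal (f x) * indicator {-y-e<..<-y+e} x \<partial>lborel)"
      using X by (intro emeasure_density) (auto simp: distributed_def)
    also have "\<dots> \<le> (\<integral>\<^sup>+x. ennreal C * indicator {-y-e<..<-y+e} x \<partial>lborel)"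
      using f by (intro nn_integral_mono mult_right_mono ennreal_leI) auto
    also have "\<dots> = ennreal (2 * C * e)"
      using \<open>0 \<le> C\<close> \<open>0 \<le> e\<close> by (simp add: nn_integral_cmult_indicator ennreal_mult[symmetric] algebra_simps)
    finally show ?thesis by (simp add: eq)
  qed
  have "emeasure M {\<omega> \<in> space M. \<bar>X \<omega> + Y \<omega>\<bar> < e} =
    emeasure (distr M (borel \<Otimes>\<^sub>M borel) (\<lambda>\<omega>. (X \<omega>, Y \<omega>))) A"
    using A by (subst emeasure_distr) (auto simp: A_def space_pair_measure intro!: arg_cong[where f = "emeasure M"])
  also have "\<dots> = emeasure (distr M borel X \<Otimes>\<^sub>M distr M borel Y) A"
    using ind by (simp add: indep_var_distribution_eq)
  also have "\<dots> = (\<integral>\<^sup>+y. emeasure (distr M borel X) ((\<lambda>x. (x, y)) -` A) \<partial>distr M borel Y)"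
    using A by (intro XY.emeasure_pair_measure_alt2) simp
  also have "\<dots> \<le> (\<integral>\<^sup>+y. ennreal (2 * C * e) \<partial>distr M borel Y)"
    by (intro nn_integral_mono slice)
  also have "\<dots> = ennreal (2 * C * e)"
    by (simp add: Y.emeasure_space_1[simplified])
  finally show ?thesis
    using \<open>0 \<le> C\<close> \<open>0 \<le> e\<close> by (simp add: emeasure_eq_measure)
qed

section \<open>Minima along grids\<close>

definition grid_min :: "real \<Rightarrow> real \<Rightarrow> (real \<Rightarrow> real) \<Rightarrow> nat \<Rightarrow> real" where
  "grid_min a b w n = Min ((\<lambda>i::nat. w (a + (b - a) * i / n)) ` {..n})"

lemma grid_min_tendsto_INF:
  assumes w: "continuous_on {a..b} w" and "a < b"
  shows "grid_min a b w \<longlonglongrightarrow> (INF s\<in>{a..b}. w s)"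
proof -
  obtain s where s: "s \<in> {a..b}" "\<And>u. u \<in> {a..b} \<Longrightarrow> w s \<le> w u"
    using continuous_attains_inf[OF compact_Icc _ w] \<open>a < b\<close> by auto
  then have INF: "(INF s\<in>{a..b}. w s) = w s"
    by (intro cInf_eq_minimum) auto
  have grid: "a + (b - a) * i / n \<in> {a..b}" if "i \<le> n" "0 < n" for i n :: nat
  proof -
    have "0 \<le> (b - a) * (i / n)" "(b - a) * (i / n) \<le> (b - a) * 1"
      using that \<open>a < b\<close> by (intro mult_nonneg_nonneg mult_left_mono; simp)+
    then show ?thesis by simp
  qed
  have lower: "w s \<le> grid_min a b w n" if "0 < n" for n
    unfolding grid_min_def using grid s(2) that by (intro Min.boundedI) auto
  show ?thesis
    unfolding INF
  proof (rule metric_LIMSEQ_I)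
    fix e :: real assume "0 < e"
    then obtain d where d: "0 < d" "\<And>u. u \<in> {a..b} \<Longrightarrow> dist u s < d \<Longrightarrow> dist (w u) (w s) < e"
      using w s(1) unfolding continuous_on_iff by blast
    obtain N where N: "(b - a) / d < real N"
      using reals_Archimedean2 by blast
    have "dist (grid_min a b w n) (w s) < e" if "Suc N \<le> n" for n
    proof -
      have n: "0 < n" "(b - a) / n < d"
        using that N d(1) \<open>a < b\<close> by (auto simp: field_simps intro: less_le_trans)
      \<comment> \<open>\<open>y\<close> is the relative position of the minimiser \<open>s\<close>.
        The grid point with the index \<open>i\<close> below is the last one not exceeding
        \<open>s\<close>, hence within \<open>(b - a) / n\<close> of it.\<close>
      define y where "y = (s - a) / (b - a)"
      have y: "0 \<le> y" "y \<le> 1" "s = a + (b - a) * y"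
        using s(1) \<open>a < b\<close> by (auto simp: y_def)
      define i where "i = nat \<lfloor>n * y\<rfloor>"
      have i: "real i \<le> n * y" "n * y < real i + 1"
        using y by (auto simp: i_def)
      have "real i \<le> n"
        using i(1) y mult_left_mono[of y 1 "real n"] by simp
      then have "i \<le> n" by simp
      have "0 \<le> (n * y - i) / n" "(n * y - i) / n \<le> 1 / n"
        using i n by (auto intro!: divide_right_mono)
      moreover have "(n * y - i) / n = y - i / n"
        using n by (simp add: diff_divide_distrib)
      ultimately have "y - i / n \<ge> 0" "y - i / n \<le> 1 / n"
        by simp_all
      then have "(b - a) * (y - i / n) \<ge> 0" "(b - a) * (y - i / n) \<le> (b - a) * (1 / n)"
        using \<open>a < b\<close> by (intro mult_nonneg_nonneg mult_left_mono; simp)+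
      then have "dist (a + (b - a) * i / n) s < d"
        using n(2) by (simp add: y(3) dist_real_def right_diff_distrib)
      then have "w (a + (b - a) * i / n) < w s + e"
        using d(2)[OF grid[OF \<open>i \<le> n\<close> n(1)]] by (simp add: dist_real_def abs_less_iff)
      moreover have "grid_min a b w n \<le> w (a + (b - a) * i / n)"
        unfolding grid_min_def using \<open>i \<le> n\<close> by (intro Min_le) auto
      ultimately show ?thesis
        using lower[OF n(1)] by (simp add: dist_real_def)
    qed
    then show "\<exists>N. \<forall>n\<ge>N. dist (grid_min a b w n) (w s) < e" by blast
  qed
qed

context standard_brownian_motion
begin

lemma distr_increment:
  assumes "0 \<le> s" "s < t"
  shows "distr M borel (\<lambda>\<omega>. B t \<omega> - B s \<omega>) = density lborel (normal_density 0 (sqrt (t - s)))"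
proof -
  have "distr M borel (\<lambda>\<omega>. B t \<omega> - B s \<omega>) = distr M lborel (\<lambda>\<omega>. B t \<omega> - B s \<omega>)"
    by (simp cong: distr_cong)
  then show ?thesis
    using normal_increments[OF assms] by (simp add: distributed_def)
qed

lemma AE_increment_neq_0:
  assumes "0 \<le> s" "s < t"
  shows "AE \<omega> in M. B t \<omega> - B s \<omega> \<noteq> 0"
proof -
  have "AE x in lborel. x \<noteq> (0::real)"
    by (rule AE_lborel_singleton)
  then have "AE x in lborel. 0 < ennreal (normal_density 0 (sqrt (t - s)) x) \<longrightarrow> x \<noteq> 0"
    by eventually_elim simp
  then show ?thesis
    using distributed_AE2[OF normal_increments[OF assms], of "\<lambda>x. x \<noteq> 0"] by simp
qed

lemma symmetric_walk_increments:
  assumes n: "0 < n"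
  shows "symmetric_walk M (\<lambda>i \<omega>. B (Suc i / n) \<omega> - B (i / n) \<omega>) n
    (density lborel (normal_density 0 (sqrt (1 / n))))"
proof
  have pos: "0 \<le> real i / n" "real i / n < real (Suc i) / n" for i
    using n by (auto simp: field_simps)
  have diff: "real (Suc i) / n - real i / n = 1 / n" for i
    using n by (simp add: field_simps)
  show "indep_vars (\<lambda>_. borel) (\<lambda>i \<omega>. B (Suc i / n) \<omega> - B (i / n) \<omega>) {..<n}"
    using indep_increments[of "\<lambda>i. real i / n" n] by (simp add: mono_on_def divide_right_mono)
  show "distr M borel (\<lambda>\<omega>. B (Suc i / n) \<omega> - B (i / n) \<omega>) =
    density lborel (normal_density 0 (sqrt (1 / n)))" for i
    using distr_increment[OF pos] unfolding diff .
  show "distr M borel (\<lambda>\<omega>. - (B (Suc i / n) \<omega> - B (i / n) \<omega>)) =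
    density lborel (normal_density 0 (sqrt (1 / n)))" for i
  proof -
    have "distributed M lborel (\<lambda>\<omega>. 0 + (-1) * (B (Suc i / n) \<omega> - B (i / n) \<omega>))
      (normal_density (0 + (-1) * 0) (\<bar>-1\<bar> * sqrt (1 / n)))"
      using normal_increments[OF pos] n unfolding diff by (intro normal_density_affine) auto
    then have "distr M lborel (\<lambda>\<omega>. - (B (Suc i / n) \<omega> - B (i / n) \<omega>)) =
      density lborel (normal_density 0 (sqrt (1 / n)))"
      by (simp add: distributed_def)
    then show ?thesis
      by (simp cong: distr_cong)
  qed
  show "AE \<omega> in M. (\<Sum>l\<in>{i..<j}. B (Suc l / n) \<omega> - B (l / n) \<omega>) \<noteq> 0" if "i < j" for i j
  proof -
    have "(\<Sum>l\<in>{i..<j}. B (Suc l / n) \<omega> - B (l / n) \<omega>) = B (j / n) \<omega> - B (i / n) \<omega>" for \<omega>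
      using that sum_Suc_diff'[of i j "\<lambda>l. B (l / n) \<omega>"] by simp
    then show ?thesis
      using AE_increment_neq_0[of "i / n" "j / n"] that n by (simp add: divide_strict_right_mono)
  qed
qed

lemma prob_grid_argmin:
  assumes "k \<le> n" "0 < n"
  shows "prob {\<omega> \<in> space M. is_last_min (\<lambda>i. B (i / n) \<omega>) n k} = arcsine_weight k * arcsine_weight (n - k)"
    and "{\<omega> \<in> space M. is_last_min (\<lambda>i. B (i / n) \<omega>) n k} \<in> events"
proof -
  interpret symmetric_walk M "\<lambda>i \<omega>. B (Suc i / n) \<omega> - B (i / n) \<omega>" n
    "density lborel (normal_density 0 (sqrt (1 / n)))"
    by (rule symmetric_walk_increments) fact
  \<comment> \<open>The walk of grid increments is \<open>B - B 0\<close>, and a constant does not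
    move the last minimum.\<close>
  have "(\<Sum>j<i. B (Suc j / n) \<omega> - B (j / n) \<omega>) = B (i / n) \<omega> - B 0 \<omega>" for i \<omega>
    using sum_lessThan_telescope[of "\<lambda>l. B (l / n) \<omega>" i] by simp
  then have "is_last_min (\<lambda>i. \<Sum>j<i. B (Suc j / n) \<omega> - B (j / n) \<omega>) n k \<longleftrightarrow> is_last_min (\<lambda>i. B (i / n) \<omega>) n k" for \<omega>
    by (simp add: is_last_min_def)
  then show "prob {\<omega> \<in> space M. is_last_min (\<lambda>i. B (i / n) \<omega>) n k} = arcsine_weight k * arcsine_weight (n - k)"
    "{\<omega> \<in> space M. is_last_min (\<lambda>i. B (i / n) \<omega>) n k} \<in> events"
    using prob_is_last_min[OF assms(1)] sets_is_last_min[of n k] by simp_all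
qed

lemma measurable_grid_min:
  assumes "0 \<le> a" "a < b"
  shows "(\<lambda>\<omega>. grid_min a b (\<lambda>t. B t \<omega>) n) \<in> borel_measurable M"
  unfolding grid_min_def using assms by (intro borel_measurable_Min measurable_B) auto

text \<open>
  The difference of the two minima is the increment over \<open>[p, q]\<close> plus a quantity that only depends on
  the increments over \<open>[0, p]\<close> and \<open>[q, 1]\<close>, so it inherits the bound on the Gaussian density.
\<close>

lemma prob_grid_min_diff_less_le:
  assumes pq: "0 < p" "p < q" "q < 1" and n: "0 < n" and e: "0 \<le> e"
  shows "prob {\<omega> \<in> space M. \<bar>grid_min q 1 (\<lambda>t. B t \<omega>) n - grid_min 0 p (\<lambda>t. B t \<omega>) n\<bar> < e} \<le>
    2 * (1 / sqrt (2 * pi * (q - p))) * e"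
proof -
  \<comment> \<open>Indices \<open>0\<close> to \<open>n\<close> run through the grid of
    \<open>[0, p]\<close> and indices \<open>n + 1\<close> to \<open>2 * n + 1\<close> through that
    of \<open>[q, 1]\<close>, so increment number \<open>n\<close> is exactly
    \<open>B q - B p\<close>.\<close>
  define t :: "nat \<Rightarrow> real" where "t i = (if i \<le> n then p * i / n else q + (1 - q) * (real i - Suc n) / n)" for i :: nat
  have t1: "t i = p * i / n" if "i \<le> n" for i :: nat using that by (simp add: t_def)
  have t2: "t (Suc n + i) = q + (1 - q) * i / n" for i :: nat by (simp add: t_def)
  have mono: "mono_on {..2 * n + 1} t"
  proof (rule mono_onI)
    fix i j :: nat assume "i \<le> j"
    have le: "p * i / n \<le> p" if "i \<le> n"
      using that pq n by (simp add: field_simps)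
    have ge: "q \<le> q + (1 - q) * (real j - Suc n) / n" if "\<not> j \<le> n"
    proof -
      have "0 \<le> (1 - q) * (real j - Suc n) / n"
        using that pq by (intro divide_nonneg_nonneg mult_nonneg_nonneg) auto
      then show ?thesis by simp
    qed
    consider "j \<le> n" | "i \<le> n" "\<not> j \<le> n" | "\<not> i \<le> n" "\<not> j \<le> n"
      using \<open>i \<le> j\<close> by linarith
    then show "t i \<le> t j"
    proof cases
      case 1
      then show ?thesis
        using \<open>i \<le> j\<close> pq by (simp add: t_def divide_right_mono mult_left_mono)
    next
      case 2
      have "t i \<le> p" "q \<le> t j"
        using le ge 2 by (auto simp: t_def)
      then show ?thesis using pq by simp
    next
      case 3
      then have "(1 - q) * (real i - Suc n) / n \<le> (1 - q) * (real j - Suc n) / n"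
        using \<open>i \<le> j\<close> pq by (intro divide_right_mono mult_left_mono) auto
      then show ?thesis using 3 by (simp add: t_def)
    qed
  qed
  define Y where "Y i \<omega> = B (t (Suc i)) \<omega> - B (t i) \<omega>" for i \<omega>
  have Y: "indep_vars (\<lambda>_. borel) Y {..<2 * n + 1}"
    unfolding Y_def using mono by (rule indep_increments[rotated]) (simp add: t_def)
  \<comment> \<open>All increments except the one over \<open>[p, q]\<close>.\<close>
  define J where "J = {..<n} \<union> {Suc n..<2 * n + 1}"
  \<comment> \<open>The grid minimum over \<open>[q, 1]\<close> relative to \<open>B q\<close>,
    minus the one over \<open>[0, p]\<close> relative to \<open>B p\<close>, both expressed by
    increments in \<open>J\<close>.\<close>
  define G where "G x = Min ((\<lambda>i. \<Sum>l\<in>{Suc n..<Suc n + i}. x l) ` {..n}) - Min ((\<lambda>i. - (\<Sum>l\<in>{i..<n}. x l)) ` {..n})"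
    for x :: "nat \<Rightarrow> real"
  have ind: "indep_var (PiM {n} (\<lambda>_. borel)) (\<lambda>\<omega>. \<lambda>i\<in>{n}. Y i \<omega>) (PiM J (\<lambda>_. borel)) (\<lambda>\<omega>. \<lambda>i\<in>J. Y i \<omega>)"
    by (intro indep_var_restrict[OF Y]) (auto simp: J_def)
  have "G \<in> borel_measurable (PiM J (\<lambda>_. borel))"
    unfolding G_def
    by (intro borel_measurable_diff borel_measurable_Min borel_measurable_uminus borel_measurable_sum
      measurable_component_singleton) (auto simp: J_def)
  then have "indep_var borel ((\<lambda>x. x n) \<circ> (\<lambda>\<omega>. \<lambda>i\<in>{n}. Y i \<omega>)) borel (G \<circ> (\<lambda>\<omega>. \<lambda>i\<in>J. Y i \<omega>))"
    by (intro indep_var_compose[OF ind]) auto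
  moreover have "(\<lambda>x. x n) \<circ> (\<lambda>\<omega>. \<lambda>i\<in>{n}. Y i \<omega>) = (\<lambda>\<omega>. B q \<omega> - B p \<omega>)"
    using n by (auto simp: fun_eq_iff Y_def t1 t2[of 0, simplified])
  ultimately have ind: "indep_var borel (\<lambda>\<omega>. B q \<omega> - B p \<omega>) borel (G \<circ> (\<lambda>\<omega>. \<lambda>i\<in>J. Y i \<omega>))"
    by simp
  have G: "(G \<circ> (\<lambda>\<omega>. \<lambda>i\<in>J. Y i \<omega>)) \<omega> =
    (grid_min q 1 (\<lambda>t. B t \<omega>) n - B q \<omega>) - (grid_min 0 p (\<lambda>t. B t \<omega>) n - B p \<omega>)" for \<omega>
  proof -
    have "(\<Sum>l\<in>{Suc n..<Suc n + i}. (\<lambda>i\<in>J. Y i \<omega>) l) = B (q + (1 - q) * i / n) \<omega> + - B q \<omega>" if "i \<le> n" for i :: nat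
    proof -
      have "(\<Sum>l\<in>{Suc n..<Suc n + i}. (\<lambda>i\<in>J. Y i \<omega>) l) = (\<Sum>l\<in>{Suc n..<Suc n + i}. Y l \<omega>)"
        using that by (intro sum.cong) (auto simp: J_def)
      then show ?thesis
        unfolding Y_def using sum_Suc_diff'[of "Suc n" "Suc n + i" "\<lambda>l. B (t l) \<omega>"] t2[of 0] t2[of i] by simp
    qed
    then have 1: "Min ((\<lambda>i. \<Sum>l\<in>{Suc n..<Suc n + i}. (\<lambda>i\<in>J. Y i \<omega>) l) ` {..n}) = grid_min q 1 (\<lambda>t. B t \<omega>) n + - B q \<omega>"
      unfolding grid_min_def by (subst Min_add_commute[symmetric]) (auto intro!: arg_cong[where f = Min] image_cong)
    have "- (\<Sum>l\<in>{i..<n}. (\<lambda>i\<in>J. Y i \<omega>) l) = B (0 + (p - 0) * i / n) \<omega> + - B p \<omega>" if "i \<le> n" for i :: nat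
    proof -
      have "(\<Sum>l\<in>{i..<n}. (\<lambda>i\<in>J. Y i \<omega>) l) = (\<Sum>l\<in>{i..<n}. Y l \<omega>)"
        using that by (intro sum.cong) (auto simp: J_def)
      then show ?thesis
        unfolding Y_def using sum_Suc_diff'[OF that, of "\<lambda>l. B (t l) \<omega>"] n t1[of n] t1[OF that] by simp
    qed
    then have 2: "Min ((\<lambda>i. - (\<Sum>l\<in>{i..<n}. (\<lambda>i\<in>J. Y i \<omega>) l)) ` {..n}) = grid_min 0 p (\<lambda>t. B t \<omega>) n + - B p \<omega>"
      unfolding grid_min_def by (subst Min_add_commute[symmetric]) (auto intro!: arg_cong[where f = Min] image_cong)
    show ?thesis
      unfolding comp_def G_def 1 2 by simp
  qed
  \<comment> \<open>The bound is the peak of the density, at 0.\<close>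
  have "normal_density 0 (sqrt (q - p)) x \<le> 1 / sqrt (2 * pi * (q - p))" for x
    using pq by (simp add: normal_density_def divide_right_mono)
  then have "prob {\<omega> \<in> space M. \<bar>(B q \<omega> - B p \<omega>) + (G \<circ> (\<lambda>\<omega>. \<lambda>i\<in>J. Y i \<omega>)) \<omega>\<bar> < e} \<le>
    2 * (1 / sqrt (2 * pi * (q - p))) * e"
    using pq e by (intro prob_abs_sum_less_le[OF ind normal_increments]) auto
  then show ?thesis
    unfolding G by simp
qed

text \<open>The bound for grid minima is uniform in \<open>n\<close>, so it survives the limit by
  Fatou's lemma: the infima coincide with probability at most \<open>C * e\<close> for every
  \<open>e > 0\<close>.\<close>

lemma AE_INF_neq:
  assumes pq: "0 < p" "p < q" "q < 1"
  shows "AE \<omega> in M. (INF t\<in>{0..p}. B t \<omega>) \<noteq> (INF t\<in>{q..1}. B t \<omega>)"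
proof -
  define Z where "Z n \<omega> = grid_min q 1 (\<lambda>t. B t \<omega>) n - grid_min 0 p (\<lambda>t. B t \<omega>) n" for n \<omega>
  define I where "I \<omega> = (INF t\<in>{q..1}. B t \<omega>) - (INF t\<in>{0..p}. B t \<omega>)" for \<omega>
  have Z[measurable]: "Z n \<in> borel_measurable M" for n
    unfolding Z_def using pq by (intro borel_measurable_diff measurable_grid_min) auto
  have lim: "(\<lambda>n. Z n \<omega>) \<longlonglongrightarrow> I \<omega>" if "\<omega> \<in> space M" for \<omega>
    unfolding Z_def I_def using pq that
    by (intro tendsto_diff grid_min_tendsto_INF continuous_on_subset[OF continuous_paths]) auto
  have I[measurable]: "I \<in> borel_measurable M"
    by (rule borel_measurable_LIMSEQ_real[OF lim]) auto
  define C where "C = 2 * (1 / sqrt (2 * pi * (q - p)))"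
  have "0 < C" using pq by (simp add: C_def)
  have *: "prob {\<omega> \<in> space M. I \<omega> = 0} \<le> C * e" if "0 < e" for e
  proof -
    have "emeasure M {\<omega> \<in> space M. I \<omega> = 0} \<le> liminf (\<lambda>n. emeasure M {\<omega> \<in> space M. \<bar>Z n \<omega>\<bar> < e})"
    proof (rule emeasure_le_liminf)
      show "AE \<omega> in M. \<omega> \<in> {\<omega> \<in> space M. I \<omega> = 0} \<longrightarrow>
        (\<forall>\<^sub>F n in sequentially. \<omega> \<in> {\<omega> \<in> space M. \<bar>Z n \<omega>\<bar> < e})"
      proof (rule AE_I2, rule impI)
        fix \<omega> assume "\<omega> \<in> {\<omega> \<in> space M. I \<omega> = 0}"
        then show "\<forall>\<^sub>F n in sequentially. \<omega> \<in> {\<omega> \<in> space M. \<bar>Z n \<omega>\<bar> < e}"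
          using tendstoD[OF lim \<open>0 < e\<close>, of \<omega>] by (simp add: dist_real_def)
      qed
    qed measurable
    also have "\<dots> \<le> limsup (\<lambda>n. emeasure M {\<omega> \<in> space M. \<bar>Z n \<omega>\<bar> < e})"
      by (intro Liminf_le_Limsup) simp
    also have "\<dots> \<le> ennreal (C * e)"
    proof (rule Limsup_bounded)
      show "\<forall>\<^sub>F n in sequentially. emeasure M {\<omega> \<in> space M. \<bar>Z n \<omega>\<bar> < e} \<le> ennreal (C * e)"
        using eventually_gt_at_top[of 0]
      proof eventually_elim
        case (elim n)
        then show ?case
          using prob_grid_min_diff_less_le[OF pq elim less_imp_le[OF that]]
          unfolding Z_def C_def emeasure_eq_measure by (intro ennreal_leI)
      qed
    qed
    finally show ?thesis
      using \<open>0 < C\<close> that by (simp add: emeasure_eq_measure)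
  qed
  have "prob {\<omega> \<in> space M. I \<omega> = 0} \<le> 0"
  proof (rule field_le_epsilon)
    fix e :: real assume "0 < e"
    with *[of "e / C"] \<open>0 < C\<close> show "prob {\<omega> \<in> space M. I \<omega> = 0} \<le> 0 + e" by simp
  qed
  then have "prob {\<omega> \<in> space M. I \<omega> = 0} = 0"
    by (simp add: measure_le_0_iff)
  then have "AE \<omega> in M. I \<omega> \<noteq> 0"
    by (subst (asm) prob_eq_0) (auto elim!: eventually_mono)
  then show ?thesis
    by eventually_elim (simp add: I_def)
qed

lemma argmin_process_0:
  assumes "\<omega> \<in> space M"
  shows "argmin_process B 0 \<omega> \<in> {0..1}"
    and "u \<in> {0..1} \<Longrightarrow> B (argmin_process B 0 \<omega>) \<omega> \<le> B u \<omega>"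
    and "s \<in> {0..1} \<Longrightarrow> (\<And>u. u \<in> {0..1} \<Longrightarrow> B s \<omega> \<le> B u \<omega>) \<Longrightarrow> s \<le> argmin_process B 0 \<omega>"
proof -
  have w: "continuous_on {0..1} (\<lambda>t. B t \<omega>)"
    by (rule continuous_on_subset[OF continuous_paths[OF assms]]) simp
  have eq: "argmin_process B 0 \<omega> = Sup {s \<in> {0..1}. B s \<omega> = (INF u\<in>{0..1}. B u \<omega>)}"
    by (simp add: argmin_process_def)
  show "argmin_process B 0 \<omega> \<in> {0..1}"
    "u \<in> {0..1} \<Longrightarrow> B (argmin_process B 0 \<omega>) \<omega> \<le> B u \<omega>"
    "s \<in> {0..1} \<Longrightarrow> (\<And>u. u \<in> {0..1} \<Longrightarrow> B s \<omega> \<le> B u \<omega>) \<Longrightarrow> s \<le> argmin_process B 0 \<omega>"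
    unfolding eq by (fact last_argmin(1)[OF w], erule last_argmin(2)[OF w], erule last_argmin(3)[OF w])
qed

text \<open>A second minimiser would lie strictly before the last one. Two rationals
  \<open>p < q\<close> between them would give equal infima over \<open>[0, p]\<close> and
  \<open>[q, 1]\<close>, which is excluded almost surely for all the countably many pairs at
  once.\<close>

lemma AE_argmin_unique:
  "AE \<omega> in M. \<forall>s\<in>{0..1}. (\<forall>u\<in>{0..1}. B s \<omega> \<le> B u \<omega>) \<longrightarrow> s = argmin_process B 0 \<omega>"
proof -
  have "AE \<omega> in M. \<forall>p\<in>\<rat>. \<forall>q\<in>\<rat>. 0 < p \<and> p < q \<and> q < 1 \<longrightarrow>
    (INF t\<in>{0..p}. B t \<omega>) \<noteq> (INF t\<in>{q..1}. B t \<omega>)"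
    using AE_INF_neq by (auto simp: AE_ball_countable countable_rat)
  with AE_space show ?thesis
  proof eventually_elim
    case (elim \<omega>)
    define \<alpha> where "\<alpha> = argmin_process B 0 \<omega>"
    note \<alpha> = argmin_process_0[OF elim(1), folded \<alpha>_def]
    show ?case
      unfolding \<alpha>_def[symmetric]
    proof (intro ballI impI)
      fix s :: real assume s: "s \<in> {0..1}" "\<forall>u\<in>{0..1}. B s \<omega> \<le> B u \<omega>"
      show "s = \<alpha>"
      proof (rule ccontr)
        assume "s \<noteq> \<alpha>"
        with \<alpha>(3)[of s] s have "s < \<alpha>" by auto
        then obtain p where p: "p \<in> \<rat>" "s < p" "p < \<alpha>" using Rats_dense_in_real by blast
        then obtain q where q: "q \<in> \<rat>" "p < q" "q < \<alpha>" using Rats_dense_in_real by blast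
        have "(INF t\<in>{0..p}. B t \<omega>) = B s \<omega>"
          using s p q \<alpha>(1) by (intro cInf_eq_minimum) auto
        moreover have "(INF t\<in>{q..1}. B t \<omega>) = B \<alpha> \<omega>"
          using s p q \<alpha>(1) by (intro cInf_eq_minimum) (auto intro!: \<alpha>(2))
        moreover have "B s \<omega> = B \<alpha> \<omega>"
          using \<alpha>(1) \<alpha>(2)[of s] s by (auto intro: antisym)
        ultimately show False
          using elim(2)[rule_format, OF p(1) q(1)] p q s \<alpha>(1) by auto
      qed
    qed
  qed
qed

section \<open>Convergence of the grid argmins\<close>

definition grid_argmin :: "nat \<Rightarrow> 'a \<Rightarrow> nat" where
  "grid_argmin n \<omega> = (THE k. is_last_min (\<lambda>i. B (i / n) \<omega>) n k)"

lemma is_last_min_iff_grid_argmin: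
  "is_last_min (\<lambda>i. B (i / n) \<omega>) n k \<longleftrightarrow> grid_argmin n \<omega> = k"
proof -
  have "\<exists>!k. is_last_min (\<lambda>i. B (i / n) \<omega>) n k"
    using is_last_min_exists is_last_min_unique by blast
  from theI'[OF this] show ?thesis
    unfolding grid_argmin_def[symmetric] using is_last_min_unique by blast
qed

text \<open>The path values at the grid argmins converge to the minimum. On the compact set
  \<open>S\<close> of times at distance at least \<open>e\<close> from \<alpha> the path stays above
  a level strictly larger than the minimum, by uniqueness; so the grid argmins eventually avoid
  \<open>S\<close>.\<close>

lemma AE_grid_argmin_tendsto:
  "AE \<omega> in M. (\<lambda>n. grid_argmin n \<omega> / n) \<longlonglongrightarrow> argmin_process B 0 \<omega>"
  using AE_argmin_unique AE_space
proof eventually_elim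
  case (elim \<omega>)
  define \<alpha> where "\<alpha> = argmin_process B 0 \<omega>"
  define w where "w t = B t \<omega>" for t
  have w: "continuous_on {0..1} w"
    unfolding w_def by (rule continuous_on_subset[OF continuous_paths]) (use elim in auto)
  note \<alpha> = argmin_process_0[OF elim(2), folded \<alpha>_def w_def]
  have INF: "(INF s\<in>{0..1}. w s) = w \<alpha>"
    using \<alpha>(1,2) by (intro cInf_eq_minimum) auto
  have last: "is_last_min (\<lambda>i. w (i / n)) n (grid_argmin n \<omega>)" for n
    unfolding w_def is_last_min_iff_grid_argmin ..
  have le: "grid_argmin n \<omega> \<le> n" for n
    using last[of n] by (simp add: is_last_min_def)
  then have in01: "grid_argmin n \<omega> / n \<in> {0..1}" for n
    by (auto simp: divide_le_eq)
  have "grid_min 0 1 w n = w (grid_argmin n \<omega> / n)" for n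
    unfolding grid_min_def using le is_last_min_le[OF last] by (intro Min_eqI) auto
  then have "grid_min 0 1 w = (\<lambda>n. w (grid_argmin n \<omega> / n))"
    by (rule ext)
  then have lim: "(\<lambda>n. w (grid_argmin n \<omega> / n)) \<longlonglongrightarrow> w \<alpha>"
    using grid_min_tendsto_INF[OF w] by (simp add: INF)
  show ?case
    unfolding \<alpha>_def[symmetric]
  proof (rule tendstoI)
    fix e :: real assume "0 < e"
    define S where "S = {s \<in> {0..1}. e \<le> dist s \<alpha>}"
    have "S = {0..1} - ball \<alpha> e" by (auto simp: S_def dist_commute)
    then have "compact S" by (simp add: compact_diff)
    show "\<forall>\<^sub>F n in sequentially. dist (grid_argmin n \<omega> / n) \<alpha> < e"
    proof (cases "S = {}")
      case True
      have "dist (grid_argmin n \<omega> / n) \<alpha> < e" for n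
      proof (rule ccontr)
        assume "\<not> dist (grid_argmin n \<omega> / n) \<alpha> < e"
        with in01[of n] have "grid_argmin n \<omega> / n \<in> S"
          unfolding S_def not_less by blast
        with True show False by blast
      qed
      then show ?thesis by simp
    next
      case False
      have "continuous_on S w"
        by (rule continuous_on_subset[OF w]) (auto simp: S_def)
      then obtain s where s: "s \<in> S" "\<And>u. u \<in> S \<Longrightarrow> w s \<le> w u"
        using continuous_attains_inf[OF \<open>compact S\<close> False] by blast
      then have "s \<noteq> \<alpha>" "s \<in> {0..1}" using \<open>0 < e\<close> by (auto simp: S_def)
      then have "\<not> (\<forall>u\<in>{0..1}. w s \<le> w u)"
        using elim(1) unfolding \<alpha>_def w_def by blast
      then have "w \<alpha> < w s"
        using \<alpha>(2) by (metis le_less_trans not_le)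
      from order_tendstoD(2)[OF lim this] show ?thesis
      proof eventually_elim
        case (elim n)
        then have "grid_argmin n \<omega> / n \<notin> S"
          using s(2) by (meson not_le)
        then show ?case
          using in01[of n] unfolding S_def mem_Collect_eq by (metis not_le)
      qed
    qed
  qed
qed

end

section \<open>The arcsine distribution\<close>

lemma measurable_arcsine_density [measurable]: "arcsine_density \<in> borel_measurable borel"
  unfolding arcsine_density_def by measurable

lemma arcsine_density_nonneg: "0 \<le> arcsine_density x"
  by (simp add: arcsine_density_def)

text \<open>Up to the factor 1 / pi this is the Beta integral with both parameters 1/2, whose value
  is the square of Gamma at 1/2, that is pi.\<close>

lemma nn_integral_arcsine_density: "(\<integral>\<^sup>+x. ennreal (arcsine_density x) \<partial>lborel) = 1"
proof -
  have "((\<lambda>t. t powr (1/2 - 1) * (1 - t) powr (1/2 - 1)) has_integral Beta (1/2) (1/2)) {0<..<1::real}"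
    using has_integral_Beta_real[of "1/2" "1/2"] by (simp add: has_integral_Icc_iff_Ioo)
  moreover have "Beta (1/2) (1/2) = pi"
    by (simp add: Beta_def Gamma_one_half_real)
  ultimately have "((\<lambda>t. t powr (1/2 - 1) * (1 - t) powr (1/2 - 1) / pi) has_integral pi / pi) {0<..<1::real}"
    by (intro has_integral_divide) simp
  moreover have "t powr (1/2 - 1) * (1 - t) powr (1/2 - 1) / pi = arcsine_density t" if "t \<in> {0<..<1}" for t
    using that by (simp add: arcsine_density_def powr_minus powr_half_sqrt real_sqrt_mult inverse_eq_divide)
  ultimately have "(arcsine_density has_integral pi / pi) {0<..<1}"
    by (rule has_integral_eq[rotated])
  then have "(arcsine_density has_integral 1) {0<..<1}"
    by simp
  then have "((\<lambda>x. if x \<in> {0<..<1} then arcsine_density x else 0) has_integral 1) UNIV"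
    by (simp only: has_integral_restrict_UNIV)
  also have "(\<lambda>x. if x \<in> {0<..<1} then arcsine_density x else 0) = arcsine_density"
    by (auto simp: arcsine_density_def)
  finally show ?thesis
    using nn_integral_has_integral_lborel[of arcsine_density 1] arcsine_density_nonneg by simp
qed

lemma prob_space_arcsine: "prob_space (density lborel arcsine_density)"
  by (rule prob_spaceI) (simp add: emeasure_density nn_integral_arcsine_density)

text \<open>The law of the grid argmin as a step density: the mass at \<open>k\<close> is spread
  evenly over the cell from \<open>k / n\<close> to \<open>(k + 1) / n\<close>, hence the factor
  \<open>n\<close>.\<close>

definition arcsine_approx :: "nat \<Rightarrow> real \<Rightarrow> real" where
  "arcsine_approx n x = n * (arcsine_weight (nat \<lfloor>n * x\<rfloor>) * arcsine_weight (n - nat \<lfloor>n * x\<rfloor>))"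

text \<open>For \<open>x\<close> strictly between 0 and 1 both \<open>k n\<close> and
  \<open>n - k n\<close> tend to infinity, so the asymptotics of the weights apply to both factors,
  while \<open>k n / n\<close> tends to \<open>x\<close>.\<close>

lemma arcsine_approx_tendsto:
  assumes x: "0 < x" "x < 1"
  shows "(\<lambda>n. arcsine_approx n x) \<longlonglongrightarrow> arcsine_density x"
proof -
  define k where "k n = nat \<lfloor>real n * x\<rfloor>" for n
  have k_real: "real (k n) = real_of_int \<lfloor>real n * x\<rfloor>" for n
    using x by (simp add: k_def)
  have k_le: "k n \<le> n" for n
  proof -
    have "real n * x \<le> real n" using x by (simp add: mult_left_le)
    then have "real (k n) \<le> real n" unfolding k_real by linarith
    then show ?thesis by simp
  qed
  have k: "filterlim k at_top sequentially"
    unfolding k_def using x by real_asymp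
  have ratio: "(\<lambda>n. real (k n) / real n) \<longlonglongrightarrow> x"
    unfolding k_real using x by real_asymp
  have "filterlim (\<lambda>n. (1 - real (k n) / real n) * real n) at_top sequentially"
    using x by (intro filterlim_tendsto_pos_mult_at_top[where c = "1 - x"] tendsto_intros ratio filterlim_real_sequentially) auto
  then have "filterlim (\<lambda>n. real (n - k n)) at_top sequentially"
    by (rule filterlim_mono_eventually[OF _ order.refl order.refl])
       (use eventually_gt_at_top[of 0] in eventually_elim, use k_le in \<open>simp add: of_nat_diff field_simps\<close>)
  then have nk: "filterlim (\<lambda>n. n - k n) at_top sequentially"
    by (simp add: filterlim_sequentially_iff_filterlim_real)
  have "(\<lambda>n. (sqrt (k n) * arcsine_weight (k n)) * (sqrt (n - k n) * arcsine_weight (n - k n)) /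
      sqrt (k n / n * (1 - k n / n))) \<longlonglongrightarrow> 1 / sqrt pi * (1 / sqrt pi) / sqrt (x * (1 - x))"
    using x by (intro tendsto_intros ratio filterlim_compose[OF arcsine_weight_asymp k]
      filterlim_compose[OF arcsine_weight_asymp nk]) auto
  moreover have "1 / sqrt pi * (1 / sqrt pi) / sqrt (x * (1 - x)) = arcsine_density x"
    using x by (simp add: arcsine_density_def)
  moreover have "\<forall>\<^sub>F n in sequentially. (sqrt (k n) * arcsine_weight (k n)) * (sqrt (n - k n) * arcsine_weight (n - k n)) /
      sqrt (k n / n * (1 - k n / n)) = arcsine_approx n x"
    using eventually_gt_at_top[of 0] filterlim_at_top_dense[THEN iffD1, OF filterlim_compose[OF filterlim_real_sequentially k], rule_format, of 0]
      filterlim_at_top_dense[THEN iffD1, OF filterlim_compose[OF filterlim_real_sequentially nk], rule_format, of 0]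
  proof eventually_elim
    case (elim n)
    have "k n / n * (1 - k n / n) = (real (k n) * real (n - k n)) / (real n)\<^sup>2"
      using k_le[of n] elim by (simp add: of_nat_diff field_simps power2_eq_square)
    then have "sqrt (k n / n * (1 - k n / n)) = sqrt (k n) * sqrt (n - k n) / n"
      by (simp add: real_sqrt_divide real_sqrt_mult)
    then show ?case
      using elim by (simp add: arcsine_approx_def k_def[symmetric])
  qed
  ultimately show ?thesis
    by (auto intro: Lim_transform_eventually)
qed

text \<open>The slack \<open>1 / n\<close> on the left is there because a point of
  \<open>[a, b]\<close> is rounded down to the grid and may drop below \<open>a\<close>.\<close>

definition grid_indices :: "real \<Rightarrow> real \<Rightarrow> nat \<Rightarrow> nat set" where
  "grid_indices a b n = {k. k \<le> n \<and> a - 1 / n \<le> k / n \<and> k / n \<le> b}"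

lemma finite_grid_indices: "finite (grid_indices a b n)"
  by (auto simp: grid_indices_def intro: finite_subset[of _ "{..n}"])

text \<open>Every point of \<open>[a, b]\<close> inside the unit interval lies in a cell
  \<open>I k\<close> with \<open>k\<close> in \<open>grid_indices a b n\<close>, and integrating the
  step density over a whole cell returns the mass at \<open>k\<close>.\<close>

lemma nn_integral_arcsine_approx_le:
  assumes "0 < n"
  shows "(\<integral>\<^sup>+x. ennreal (arcsine_approx n x) * indicator ({a..b} \<inter> {0<..<1}) x \<partial>lborel) \<le>
    ennreal (\<Sum>k\<in>grid_indices a b n. arcsine_weight k * arcsine_weight (n - k))"
proof -
  define I where "I k = {real k / n..<(real k + 1) / n}" for k :: nat
  define c where "c k = n * (arcsine_weight k * arcsine_weight (n - k))" for k
  have c: "0 \<le> c k" for k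
    by (simp add: c_def arcsine_weight_nonneg)
  have "ennreal (arcsine_approx n x) * indicator ({a..b} \<inter> {0<..<1}) x \<le>
    (\<Sum>k\<in>grid_indices a b n. ennreal (c k) * indicator (I k) x)" for x
  proof (cases "x \<in> {a..b} \<inter> {0<..<1}")
    case True
    define k where "k = nat \<lfloor>n * x\<rfloor>"
    have k: "real k \<le> n * x" "n * x < real k + 1"
      using True by (auto simp: k_def)
    have "real n * x \<le> real n" using True by (simp add: mult_left_le)
    with k have "k \<le> n" by linarith
    have "(n * x - 1) / n \<le> k / n"
      using k by (auto intro!: divide_right_mono)
    then have "x - 1 / n \<le> k / n"
      using \<open>0 < n\<close> by (simp add: diff_divide_distrib)
    have "k / n \<le> x"
      using k(1) \<open>0 < n\<close> by (simp add: divide_le_eq mult.commute)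
    with True \<open>k \<le> n\<close> \<open>x - 1 / n \<le> k / n\<close> have "k \<in> grid_indices a b n"
      by (auto simp: grid_indices_def)
    moreover have "x \<in> I k"
      using k \<open>0 < n\<close> by (simp add: I_def field_simps)
    moreover have "arcsine_approx n x = c k"
      by (simp add: arcsine_approx_def c_def k_def)
    ultimately show ?thesis
      using True member_le_sum[of k "grid_indices a b n" "\<lambda>k. ennreal (c k) * indicator (I k) x"] finite_grid_indices
      by simp
  qed simp
  then have "(\<integral>\<^sup>+x. ennreal (arcsine_approx n x) * indicator ({a..b} \<inter> {0<..<1}) x \<partial>lborel) \<le>
    (\<integral>\<^sup>+x. (\<Sum>k\<in>grid_indices a b n. ennreal (c k) * indicator (I k) x) \<partial>lborel)"
    by (intro nn_integral_mono)
  also have "\<dots> = (\<Sum>k\<in>grid_indices a b n. ennreal (c k) * emeasure lborel (I k))"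
    by (simp add: nn_integral_sum nn_integral_cmult_indicator I_def)
  also have "\<dots> = (\<Sum>k\<in>grid_indices a b n. ennreal (arcsine_weight k * arcsine_weight (n - k)))"
  proof (rule sum.cong)
    fix k
    have "emeasure lborel (I k) = ennreal (1 / n)"
      using \<open>0 < n\<close> by (simp add: I_def divide_right_mono diff_divide_distrib[symmetric])
    then show "ennreal (c k) * emeasure lborel (I k) = ennreal (arcsine_weight k * arcsine_weight (n - k))"
      using c \<open>0 < n\<close> by (simp add: ennreal_mult[symmetric]) (simp add: c_def)
  qed simp
  also have "\<dots> = ennreal (\<Sum>k\<in>grid_indices a b n. arcsine_weight k * arcsine_weight (n - k))"
    by (intro sum_ennreal) (simp add: arcsine_weight_nonneg)
  finally show ?thesis .
qed

text \<open>Fatou's lemma for the step densities. They are cut off outside the open unit interval,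
  where the arcsine density vanishes and pointwise convergence was not shown.\<close>

lemma emeasure_arcsine_le_liminf:
  "emeasure (density lborel arcsine_density) {a..b} \<le>
    liminf (\<lambda>n. ennreal (\<Sum>k\<in>grid_indices a b n. arcsine_weight k * arcsine_weight (n - k)))"
proof -
  let ?I = "indicator ({a..b} \<inter> {0<..<1}) :: real \<Rightarrow> ennreal"
  have [measurable]: "arcsine_approx n \<in> borel_measurable borel" for n
    unfolding arcsine_approx_def by measurable
  have "ennreal (arcsine_density x) * indicator {a..b} x = liminf (\<lambda>n. ennreal (arcsine_approx n x) * ?I x)" for x
  proof (cases "x \<in> {a..b} \<inter> {0<..<1}")
    case True
    then have "(\<lambda>n. ennreal (arcsine_approx n x)) \<longlonglongrightarrow> ennreal (arcsine_density x)"
      by (intro tendsto_ennrealI arcsine_approx_tendsto) auto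
    then show ?thesis
      using True by (simp add: lim_imp_Liminf)
  next
    case False
    then have "ennreal (arcsine_density x) * indicator {a..b} x = 0"
      by (auto simp: arcsine_density_def indicator_def)
    then show ?thesis using False by (simp add: Liminf_const)
  qed
  then have "emeasure (density lborel arcsine_density) {a..b} =
    (\<integral>\<^sup>+x. liminf (\<lambda>n. ennreal (arcsine_approx n x) * ?I x) \<partial>lborel)"
    by (simp add: emeasure_density)
  also have "\<dots> \<le> liminf (\<lambda>n. \<integral>\<^sup>+x. ennreal (arcsine_approx n x) * ?I x \<partial>lborel)"
    by (intro nn_integral_liminf) measurable
  also have "\<dots> \<le> liminf (\<lambda>n. ennreal (\<Sum>k\<in>grid_indices a b n. arcsine_weight k * arcsine_weight (n - k)))"
    by (intro Liminf_mono eventually_mono[OF eventually_gt_at_top[of 0]] nn_integral_arcsine_approx_le)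
  finally show ?thesis .
qed

section \<open>The law of the argmin at a fixed time\<close>

lemma eventually_less_of_le_liminf:
  assumes "ennreal v \<le> liminf (\<lambda>n. ennreal (x n))" "0 \<le> v'" "v' < v"
  shows "\<forall>\<^sub>F n in sequentially. v' < x n"
proof -
  have "ennreal v' < liminf (\<lambda>n. ennreal (x n))"
    using assms by (intro less_le_trans[OF _ assms(1)]) (simp add: ennreal_lessI)
  from less_LiminfD[OF this] show ?thesis
    by eventually_elim (use assms in \<open>simp add: ennreal_less_iff\<close>)
qed

text \<open>Two Fatou bounds are combined. If the argmin is outside \<open>[a, b]\<close>, the grid
  argmins eventually avoid \<open>grid_indices a b n\<close>, which bounds \<open>prob A\<close> by
  the lower limit of \<open>prob (F n)\<close>; the arcsine mass of \<open>[a, b]\<close> is at most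
  the lower limit of \<open>p n\<close>. Since \<open>prob (F n) + p n = 1\<close> for
  \<open>n > 0\<close>, the two masses add up to at most 1.\<close>

lemma (in standard_brownian_motion) arcsine_le_distr_argmin:
  "measure (density lborel arcsine_density) {a..b} \<le> prob {\<omega> \<in> space M. argmin_process B 0 \<omega> \<in> {a..b}}"
proof -
  interpret arcsine: prob_space "density lborel arcsine_density"
    by (rule prob_space_arcsine)
  have [measurable]: "argmin_process B 0 \<in> borel_measurable M"
    using stationary_argmin_process[OF standard_brownian_motion_axioms]
    by (simp add: stationary_process_def)
  define A where "A = {\<omega> \<in> space M. argmin_process B 0 \<omega> \<notin> {a..b}}"
  have A: "A \<in> events" unfolding A_def by measurable
  define E where "E n = {\<omega> \<in> space M. grid_argmin n \<omega> \<in> grid_indices a b n}" for n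
  define p where "p n = (\<Sum>k\<in>grid_indices a b n. arcsine_weight k * arcsine_weight (n - k))" for n
  have E: "E n \<in> events" "prob (E n) = p n" if "0 < n" for n
  proof -
    have *: "{\<omega> \<in> space M. grid_argmin n \<omega> = k} \<in> events"
      "prob {\<omega> \<in> space M. grid_argmin n \<omega> = k} = arcsine_weight k * arcsine_weight (n - k)"
      if "k \<in> grid_indices a b n" for k
      using prob_grid_argmin[of k n] that \<open>0 < n\<close>
      by (auto simp: is_last_min_iff_grid_argmin grid_indices_def)
    have "E n = (\<Union>k\<in>grid_indices a b n. {\<omega> \<in> space M. grid_argmin n \<omega> = k})"
      by (auto simp: E_def)
    moreover have "prob (\<Union>k\<in>grid_indices a b n. {\<omega> \<in> space M. grid_argmin n \<omega> = k}) = p n"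
      unfolding p_def using * by (subst finite_measure_finite_Union) (auto simp: finite_grid_indices disjoint_family_on_def)
    ultimately show "E n \<in> events" "prob (E n) = p n"
      using * finite_grid_indices by auto
  qed
  \<comment> \<open>\<open>n = 0\<close> gets a dummy value, as measurability of \<open>E n\<close>
    is established for positive \<open>n\<close>.\<close>
  define F where "F n = space M - (if n = 0 then {} else E n)" for n
  have F: "F n \<in> events" for n
    using E by (auto simp: F_def)
  have "emeasure M A \<le> liminf (\<lambda>n. emeasure M (F n))"
  proof (rule emeasure_le_liminf[OF A F])
    show "AE \<omega> in M. \<omega> \<in> A \<longrightarrow> (\<forall>\<^sub>F n in sequentially. \<omega> \<in> F n)"
      using AE_grid_argmin_tendsto AE_space
    proof eventually_elim
      case (elim \<omega>)
      let ?\<alpha> = "argmin_process B 0 \<omega>"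
      show ?case
      proof
        assume "\<omega> \<in> A"
        then consider "?\<alpha> < a" | "b < ?\<alpha>"
          by (auto simp: A_def not_le)
        then have "\<forall>\<^sub>F n in sequentially. grid_argmin n \<omega> \<notin> grid_indices a b n"
        proof cases
          case 1
          \<comment> \<open>The added \<open>1 / n\<close> absorbs the slack on the left of
            \<open>grid_indices\<close>.\<close>
          have "(\<lambda>n. grid_argmin n \<omega> / n + 1 / n) \<longlonglongrightarrow> ?\<alpha> + 0"
            by (intro tendsto_add elim lim_1_over_n)
          from order_tendstoD(2)[OF this, of a] 1 show ?thesis
            by (auto elim!: eventually_mono simp: grid_indices_def)
        next
          case 2
          from order_tendstoD(1)[OF elim(1) 2] show ?thesis
            by (auto elim!: eventually_mono simp: grid_indices_def)
        qed
        then show "\<forall>\<^sub>F n in sequentially. \<omega> \<in> F n"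
          by eventually_elim (use elim in \<open>auto simp: F_def E_def\<close>)
      qed
    qed
  qed
  then have u: "ennreal (prob A) \<le> liminf (\<lambda>n. ennreal (prob (F n)))"
    by (simp add: emeasure_eq_measure)
  have v: "ennreal (measure (density lborel arcsine_density) {a..b}) \<le> liminf (\<lambda>n. ennreal (p n))"
    unfolding p_def using emeasure_arcsine_le_liminf[of a b] by (simp add: arcsine.emeasure_eq_measure)
  have "prob A + measure (density lborel arcsine_density) {a..b} \<le> 1"
  proof (rule ccontr)
    assume "\<not> ?thesis"
    then have "1 - prob A < measure (density lborel arcsine_density) {a..b}" by simp
    \<comment> \<open>For \<open>c\<close> in between, all large \<open>n\<close> would satisfy
      \<open>c < p n\<close> and \<open>1 - c < prob (F n)\<close>, although the two probabilities
      add up to 1.\<close>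
    then obtain c where c: "1 - prob A < c" "c < measure (density lborel arcsine_density) {a..b}"
      using dense by blast
    have "0 \<le> c" using c(1) prob_le_1[of A] by linarith
    have "c < 1" using c(2) arcsine.prob_le_1[of "{a..b}"] by linarith
    have "\<forall>\<^sub>F n in sequentially. c < p n"
      by (rule eventually_less_of_le_liminf[OF v \<open>0 \<le> c\<close> c(2)])
    moreover have "\<forall>\<^sub>F n in sequentially. 1 - c < prob (F n)"
      by (rule eventually_less_of_le_liminf[OF u]) (use c \<open>c < 1\<close> in simp_all)
    ultimately have "\<forall>\<^sub>F n::nat in sequentially. False"
      using eventually_gt_at_top[of 0]
    proof eventually_elim
      case (elim n)
      then show ?case
        using E[of n] prob_compl[of "E n"] by (simp add: F_def)
    qed
    then show False by simp
  qed
  moreover have "{\<omega> \<in> space M. argmin_process B 0 \<omega> \<in> {a..b}} = space M - A"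
    by (auto simp: A_def)
  ultimately show ?thesis
    using prob_compl[OF A] by simp
qed

text \<open>The inequality passes to left and right rays by monotone limits. As both total masses
  are 1, the bound on right rays becomes the reverse bound on their complements, so the distribution
  functions agree.\<close>

lemma real_distribution_eqI_le_Icc:
  assumes N: "real_distribution N" and N': "real_distribution N'"
    and le: "\<And>a b. measure N {a..b} \<le> measure N' {a..b}"
  shows "N = N'"
proof (rule cdf_unique[OF N N'], rule ext)
  fix x
  interpret N: real_distribution N by fact
  interpret N': real_distribution N' by fact
  have le_ray: "measure N (\<Union>n::nat. {f n..g n}) \<le> measure N' (\<Union>n. {f n..g n})"
    if "incseq (\<lambda>n. {f n..g n})" for f g :: "nat \<Rightarrow> real"
    by (rule LIMSEQ_le[OF N.finite_Lim_measure_incseq[OF _ that] N'.finite_Lim_measure_incseq[OF _ that]])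
       (use le in auto)
  have ray1: "(\<Union>n::nat. {y - real n..y}) = {..y}" for y :: real
  proof safe
    fix z assume "z \<le> y"
    then obtain n :: nat where "y - z \<le> n" using real_arch_simple by blast
    then show "z \<in> (\<Union>n::nat. {y - real n..y})" using \<open>z \<le> y\<close> by (auto intro!: exI[of _ n])
  qed auto
  have ray2: "(\<Union>n::nat. {y..y + real n}) = {y..}" for y :: real
  proof safe
    fix z assume "y \<le> z"
    then obtain n :: nat where "z - y \<le> n" using real_arch_simple by blast
    then show "z \<in> (\<Union>n::nat. {y..y + real n})" using \<open>y \<le> z\<close> by (auto intro!: exI[of _ n])
  qed auto
  have left: "measure N {..y} \<le> measure N' {..y}" for y
    using le_ray[of "\<lambda>n. y - n" "\<lambda>n. y"] unfolding ray1 by (auto simp: incseq_def)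
  have right: "measure N {y..} \<le> measure N' {y..}" for y
    using le_ray[of "\<lambda>n. y" "\<lambda>n. y + n"] unfolding ray2 by (auto simp: incseq_def)
  show "cdf N x = cdf N' x"
  proof (rule antisym)
    show "cdf N x \<le> cdf N' x" using left by (simp add: cdf_def)
    \<comment> \<open>The complement of a closed right ray is an open left ray, so the reverse bound
      is first obtained with \<open>y > x\<close>; right continuity of \<open>cdf N\<close> then
      closes the gap.\<close>
    have "cdf N' x \<le> cdf N y" if "x < y" for y
    proof -
      have "measure N' {..x} \<le> measure N' {..<y}"
        using that by (intro N'.finite_measure_mono) auto
      also have "\<dots> = 1 - measure N' {y..}"
        using N'.prob_compl[of "{y..}"] by (simp add: Compl_eq_Diff_UNIV[symmetric])
      also have "\<dots> \<le> 1 - measure N {y..}" using right by simp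
      also have "\<dots> = measure N {..<y}"
        using N.prob_compl[of "{y..}"] by (simp add: Compl_eq_Diff_UNIV[symmetric])
      also have "\<dots> \<le> measure N {..y}"
        by (intro N.finite_measure_mono) auto
      finally show ?thesis by (simp add: cdf_def)
    qed
    then have "\<forall>\<^sub>F y in at_right x. cdf N' x \<le> cdf N y"
      by (auto simp: eventually_at_right_field intro!: exI[of _ "x + 1"])
    then show "cdf N' x \<le> cdf N x"
      using N.cdf_is_right_cont[of x]
      by (intro tendsto_lowerbound[of "cdf N" _ "at_right x"]) (auto simp: continuous_within)
  qed
qed

text \<open>Domination on closed intervals suffices, because both sides are probability
  measures.\<close>

lemma (in standard_brownian_motion) distr_argmin_0:
  "distr M borel (argmin_process B 0) = density lborel arcsine_density"
proof -
  have [measurable]: "argmin_process B 0 \<in> borel_measurable M"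
    using stationary_argmin_process[OF standard_brownian_motion_axioms]
    by (simp add: stationary_process_def)
  show ?thesis
  proof (rule real_distribution_eqI_le_Icc[symmetric])
    show "real_distribution (density lborel arcsine_density)"
      using prob_space_arcsine by (simp add: real_distribution_def real_distribution_axioms_def)
    show "real_distribution (distr M borel (argmin_process B 0))"
      by (simp add: real_distribution_distr)
    show "measure (density lborel arcsine_density) {a..b} \<le> measure (distr M borel (argmin_process B 0)) {a..b}" for a b
      using arcsine_le_distr_argmin[of a b] by (simp add: measure_distr vimage_def Int_def conj_commute)
  qed
qed

text \<open>This is shift invariance for \<open>J = {0}\<close> and \<open>h = t\<close>; projecting
  the one-point product to its coordinate recovers the law of a single variable.\<close>

lemma distr_stationary_process:
  assumes X: "stationary_process M X" and t: "0 \<le> t"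
  shows "distr M borel (X t) = distr M borel (X 0)"
proof -
  have [measurable]: "X s \<in> borel_measurable M" if "0 \<le> s" for s
    using X that by (simp add: stationary_process_def)
  have m: "(\<lambda>\<omega>. \<lambda>j\<in>{0}. X (j + h) \<omega>) \<in> M \<rightarrow>\<^sub>M PiM {0} (\<lambda>_. borel)" if "0 \<le> h" for h
    using that by (intro measurable_restrict) auto
  have eq: "distr M borel (X h) =
    distr (distr M (PiM {0} (\<lambda>_. borel)) (\<lambda>\<omega>. \<lambda>j\<in>{0}. X (j + h) \<omega>)) borel (\<lambda>w. w 0)" if "0 \<le> h" for h
    by (subst distr_distr[OF _ m[OF that]]) (auto simp: comp_def)
  have "distr M (PiM {0} (\<lambda>_. borel)) (\<lambda>\<omega>. \<lambda>j\<in>{0}. X (j + t) \<omega>) =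
    distr M (PiM {0} (\<lambda>_. borel)) (\<lambda>\<omega>. \<lambda>j\<in>{0::real}. X j \<omega>)"
    using X t unfolding stationary_process_def by simp
  then show ?thesis
    using eq[OF t] eq[of 0] by simp
qed

theorem proposition1p1:
  fixes M :: "'a measure" and B :: "real \<Rightarrow> 'a \<Rightarrow> real"
  assumes "standard_brownian_motion M B"
  shows "stationary_process M (argmin_process B) \<and>
    (\<forall>t\<ge>0. distributed M lborel (argmin_process B t) arcsine_density)"
proof (intro conjI allI impI)
  interpret standard_brownian_motion M B by fact
  show stat: "stationary_process M (argmin_process B)"
    by (rule stationary_argmin_process) fact
  fix t :: real assume "0 \<le> t"
  have "distr M lborel (argmin_process B t) = distr M borel (argmin_process B t)"
    by (simp cong: distr_cong)
  also have "\<dots> = density lborel arcsine_density"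
    using distr_stationary_process[OF stat \<open>0 \<le> t\<close>] distr_argmin_0 by simp
  finally show "distributed M lborel (argmin_process B t) arcsine_density"
    using stat \<open>0 \<le> t\<close> by (simp add: distributed_def stationary_process_def)
qed

end
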